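(* Let $(M^{3},\varphi,\xi,\eta,g)$ be a three-dimensional para-Sasakian manifold with scalar curvature $r=-6$. If $g$ is a Yamabe soliton, then $g$ is also a Ricci soliton.
   Context: All manifolds are smooth and connected. An almost paracontact structure on a $(2n+1)$-dimensional manifold $M$ consists of a $(1,1)$-tensor field $\varphi$, a vector field $\xi$ and a $1$-form $\eta$ with $\eta(\xi)=1$, $\varphi^2=I-\eta\otimes\xi$, such that the $\pm1$-eigendistributions of $\varphi$ restricted to $\ker\eta$ both have dimension $n$ (so $\varphi\xi=0$, $\eta\circ\varphi=0$). It is an almost paracontact metric manifold if equipped with a semi-Riemannian metric $g$ with $g(\varphi X,\varphi Y)=-g(X,Y)+\eta(X)\eta(Y)$ for all $X,Y$. Its fundamental $2$-form is $\Phi(X,Y)=g(X,\varphi Y)$. It is normal if $[\varphi,\varphi]-2d\eta\otimes\xi=0$, where $[\varphi,\varphi](X,Y)=\varphi^2[X,Y]+[\varphi X,\varphi Y]-\varphi[\varphi X,Y]-\varphi[X,\varphi Y]$, and it is a paracontact metric manifold if $d\eta=\Phi$; here $2\,d\eta(X,Y)=X\eta(Y)-Y\eta(X)-\eta([X,Y])$. A para-Sasakian manifold is a normal paracontact metric manifold; with these conventions it satisfies $\nabla_X\xi=-\varphi X$ and $(\nabla_X\varphi)Y=-g(X,Y)\xi+\eta(Y)X$, where $\nabla$ is the Levi-Civita connection. Curvature convention: $R(X,Y)Z=\nabla_X\nabla_YZ-\nabla_Y\nabla_XZ-\nabla_{[X,Y]}Z$, the Ricci tensor is $S(X,Y)=\operatorname{trace}\{Z\mapsto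 R(Z,X)Y\}$, and the scalar curvature $r$ is the $g$-trace of $S$. A semi-Riemannian metric $g$ is a Yamabe soliton if there are a vector field $V$ and a real number $\lambda$ with $\mathcal{L}_Vg=(\lambda-r)g$. It is a Ricci soliton if there are a vector field $V$ and a constant $\mu\in\mathbb{R}$ with $(\mathcal{L}_Vg)(X,Y)+2S(X,Y)+2\mu g(X,Y)=0$ for all vector fields $X,Y$. $\mathcal{L}$ denotes the Lie derivative. *)

theory Defs
  imports "HOL-Analysis.Analysis"
begin

section \<open>Smooth maps between open subsets of normed spaces\<close>

primrec Ck_on ::
  "nat \<Rightarrow> ('b::real_normed_vector \<Rightarrow> 'c::real_normed_vector) \<Rightarrow> 'b set \<Rightarrow> bool" where
  "Ck_on 0 f U = continuous_on U f"
| "Ck_on (Suc k) f U =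
     ((\<forall>x\<in>U. f differentiable at x) \<and>
      (\<forall>v. Ck_on k (\<lambda>x. frechet_derivative f (at x) v) U))"

text \<open>Used only for open \<open>U\<close> in finite-dimensional spaces, where it is the usual notion.\<close>

definition smooth_on ::
  "('b::real_normed_vector \<Rightarrow> 'c::real_normed_vector) \<Rightarrow> 'b set \<Rightarrow> bool" where
  "smooth_on f U \<longleftrightarrow> (\<forall>k. Ck_on k f U)"


section \<open>Smooth manifolds\<close>

text \<open>
  The manifold is the whole type \<open>'a\<close>, and its dimension is \<open>CARD('n)\<close>. A chart is a pair of
  its domain and its coordinate map; the values of the map outside the domain are irrelevant.
\<close>

type_synonym ('a, 'n) chart = "'a set \<times> ('a \<Rightarrow> real ^ 'n)"
type_synonym ('a, 'n) atlas = "('a, 'n) chart set"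

definition chart_inv :: "('a, 'n) chart \<Rightarrow> real ^ 'n \<Rightarrow> 'a" where
  "chart_inv c = inv_into (fst c) (snd c)"

definition smooth_manifold ::
  "('a::{t2_space, second_countable_topology}, 'n::finite) atlas \<Rightarrow> bool" where
  "smooth_manifold A \<longleftrightarrow>
     connected (UNIV :: 'a set) \<and>
     (\<Union>c\<in>A. fst c) = UNIV \<and>
     (\<forall>c\<in>A. open (fst c) \<and> open (snd c ` fst c) \<and>
        homeomorphism (fst c) (snd c ` fst c) (snd c) (chart_inv c)) \<and>
     (\<forall>c\<in>A. \<forall>c'\<in>A. smooth_on (snd c' \<circ> chart_inv c) (snd c ` (fst c \<inter> fst c')))"

definition chart_at :: "('a, 'n) atlas \<Rightarrow> 'a \<Rightarrow> ('a, 'n) chart" where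
  "chart_at A p = (SOME c. c \<in> A \<and> p \<in> fst c)"


section \<open>Functions and vector fields\<close>

text \<open>
  The tangent space at \<open>p\<close> is \<open>real ^ 'n\<close>: a tangent vector is given by its components with
  respect to the preferred chart \<open>chart_at A p\<close>. Its components in another chart around \<open>p\<close>
  are obtained with the derivative of the coordinate change. The preferred chart jumps from
  point to point, so smoothness of a field \<open>X\<close> is \<^emph>\<open>not\<close> smoothness of \<open>X\<close> as a vector-valued
  function; it is tested on the components in each fixed chart.
\<close>

definition coord_change ::
  "('a, 'n::finite) chart \<Rightarrow> ('a, 'n) chart \<Rightarrow> 'a \<Rightarrow> real ^ 'n \<Rightarrow> real ^ 'n" where
  "coord_change c c' p = frechet_derivative (snd c' \<circ> chart_inv c) (at (snd c p))"

definition fun_rep :: "('a, 'n) chart \<Rightarrow> ('a \<Rightarrow> real) \<Rightarrow> real ^ 'n \<Rightarrow> real" where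
  "fun_rep c f = f \<circ> chart_inv c"

definition vf_rep ::
  "('a, 'n::finite) atlas \<Rightarrow> ('a, 'n) chart \<Rightarrow> ('a \<Rightarrow> real ^ 'n) \<Rightarrow> real ^ 'n \<Rightarrow> real ^ 'n" where
  "vf_rep A c X = (\<lambda>x. let p = chart_inv c x in coord_change (chart_at A p) c p (X p))"

definition smooth_fun_on ::
  "('a, 'n::finite) atlas \<Rightarrow> 'a set \<Rightarrow> ('a \<Rightarrow> real) \<Rightarrow> bool" where
  "smooth_fun_on A W f \<longleftrightarrow> (\<forall>c\<in>A. smooth_on (fun_rep c f) (snd c ` (fst c \<inter> W)))"

definition vector_field_on ::
  "('a, 'n::finite) atlas \<Rightarrow> 'a set \<Rightarrow> ('a \<Rightarrow> real ^ 'n) \<Rightarrow> bool" where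
  "vector_field_on A W X \<longleftrightarrow> (\<forall>c\<in>A. smooth_on (vf_rep A c X) (snd c ` (fst c \<inter> W)))"

definition differential ::
  "('a, 'n::finite) atlas \<Rightarrow> ('a \<Rightarrow> real) \<Rightarrow> 'a \<Rightarrow> real ^ 'n \<Rightarrow> real" where
  "differential A f p =
     frechet_derivative (fun_rep (chart_at A p) f) (at (snd (chart_at A p) p))"

text \<open>
  In coordinates, \<open>[X, Y] = D Y (X) - D X (Y)\<close>. In the preferred chart at \<open>p\<close> the
  components of \<open>X p\<close> are \<open>X p\<close> itself.
\<close>

definition lie_bracket ::
  "('a, 'n::finite) atlas \<Rightarrow> ('a \<Rightarrow> real ^ 'n) \<Rightarrow> ('a \<Rightarrow> real ^ 'n) \<Rightarrow> 'a \<Rightarrow> real ^ 'n" where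
  "lie_bracket A X Y p =
     (let c = chart_at A p; x = snd c p in
        frechet_derivative (vf_rep A c Y) (at x) (X p) -
        frechet_derivative (vf_rep A c X) (at x) (Y p))"


section \<open>Tensor fields\<close>

text \<open>
  Tensor fields are families of (multi)linear maps on the tangent spaces. Here and below,
  smoothness and identities between tensors are expressed with vector fields on arbitrary
  open subsets \<open>W\<close> of the manifold (among them the manifold itself).
\<close>

definition one_form ::
  "('a::topological_space, 'n::finite) atlas \<Rightarrow> ('a \<Rightarrow> real ^ 'n \<Rightarrow> real) \<Rightarrow> bool" where
  "one_form A \<eta> \<longleftrightarrow>
     (\<forall>p. linear (\<eta> p)) \<and>
     (\<forall>W X. open W \<longrightarrow> vector_field_on A W X \<longrightarrow> smooth_fun_on A W (\<lambda>p. \<eta> p (X p)))"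

definition endo_field ::
  "('a::topological_space, 'n::finite) atlas \<Rightarrow> ('a \<Rightarrow> real ^ 'n \<Rightarrow> real ^ 'n) \<Rightarrow> bool" where
  "endo_field A \<phi> \<longleftrightarrow>
     (\<forall>p. linear (\<phi> p)) \<and>
     (\<forall>W X. open W \<longrightarrow> vector_field_on A W X \<longrightarrow> vector_field_on A W (\<lambda>p. \<phi> p (X p)))"

text \<open>The index of \<open>g\<close> is automatically constant since the manifold is connected.\<close>

definition semi_riemannian_metric ::
  "('a::topological_space, 'n::finite) atlas \<Rightarrow> ('a \<Rightarrow> real ^ 'n \<Rightarrow> real ^ 'n \<Rightarrow> real) \<Rightarrow> bool" where
  "semi_riemannian_metric A g \<longleftrightarrow>
     (\<forall>p. bilinear (g p) \<and>
          (\<forall>u v. g p u v = g p v u) \<and>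
          (\<forall>u. (\<forall>v. g p u v = 0) \<longrightarrow> u = 0)) \<and>
     (\<forall>W X Y. open W \<longrightarrow> vector_field_on A W X \<longrightarrow> vector_field_on A W Y \<longrightarrow>
        smooth_fun_on A W (\<lambda>p. g p (X p) (Y p)))"

definition lie_derivative ::
  "('a, 'n::finite) atlas \<Rightarrow> ('a \<Rightarrow> real ^ 'n) \<Rightarrow> ('a \<Rightarrow> real ^ 'n \<Rightarrow> real ^ 'n \<Rightarrow> real) \<Rightarrow>
   ('a \<Rightarrow> real ^ 'n) \<Rightarrow> ('a \<Rightarrow> real ^ 'n) \<Rightarrow> 'a \<Rightarrow> real" where
  "lie_derivative A V g X Y p =
     differential A (\<lambda>q. g q (X q) (Y q)) p (V p)
       - g p (lie_bracket A V X p) (Y p) - g p (X p) (lie_bracket A V Y p)"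


section \<open>Levi-Civita connection and curvature\<close>

text \<open>
  A connection maps a tangent vector \<open>v\<close> at \<open>p\<close> and a vector field \<open>Y\<close>, smooth near \<open>p\<close>, to
  \<open>nabla p v Y\<close> in the tangent space at \<open>p\<close>. For \<open>Y\<close> that is not smooth near \<open>p\<close> nothing
  is required.
\<close>

type_synonym ('a, 'n) connection = "'a \<Rightarrow> real ^ 'n \<Rightarrow> ('a \<Rightarrow> real ^ 'n) \<Rightarrow> real ^ 'n"

definition cov ::
  "('a, 'n) connection \<Rightarrow> ('a \<Rightarrow> real ^ 'n) \<Rightarrow> ('a \<Rightarrow> real ^ 'n) \<Rightarrow> 'a \<Rightarrow> real ^ 'n" where
  "cov nabla X Y = (\<lambda>p. nabla p (X p) Y)"

definition affine_connection ::
  "('a::topological_space, 'n::finite) atlas \<Rightarrow> ('a, 'n) connection \<Rightarrow> bool" where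
  "affine_connection A nabla \<longleftrightarrow>
     (\<forall>W Y. open W \<longrightarrow> vector_field_on A W Y \<longrightarrow>
        (\<forall>p\<in>W. linear (\<lambda>v. nabla p v Y)) \<and>
        (\<forall>Z. vector_field_on A W Z \<longrightarrow>
           (\<forall>p\<in>W. \<forall>v. nabla p v (\<lambda>q. Y q + Z q) = nabla p v Y + nabla p v Z)) \<and>
        (\<forall>f. smooth_fun_on A W f \<longrightarrow>
           (\<forall>p\<in>W. \<forall>v. nabla p v (\<lambda>q. f q *\<^sub>R Y q) =
              differential A f p v *\<^sub>R Y p + f p *\<^sub>R nabla p v Y)) \<and>
        (\<forall>Z. (\<forall>q\<in>W. Z q = Y q) \<longrightarrow> (\<forall>p\<in>W. \<forall>v. nabla p v Z = nabla p v Y)) \<and>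
        (\<forall>X. vector_field_on A W X \<longrightarrow> vector_field_on A W (cov nabla X Y)))"

definition levi_civita_connection ::
  "('a::topological_space, 'n::finite) atlas \<Rightarrow> ('a \<Rightarrow> real ^ 'n \<Rightarrow> real ^ 'n \<Rightarrow> real) \<Rightarrow>
   ('a, 'n) connection \<Rightarrow> bool" where
  "levi_civita_connection A g nabla \<longleftrightarrow>
     affine_connection A nabla \<and>
     (\<forall>W X Y. open W \<longrightarrow> vector_field_on A W X \<longrightarrow> vector_field_on A W Y \<longrightarrow>
        (\<forall>p\<in>W. cov nabla X Y p - cov nabla Y X p = lie_bracket A X Y p) \<and>
        (\<forall>p\<in>W. \<forall>v. differential A (\<lambda>q. g q (X q) (Y q)) p v =
           g p (nabla p v X) (Y p) + g p (X p) (nabla p v Y)))"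

definition curvature ::
  "('a, 'n::finite) atlas \<Rightarrow> ('a, 'n) connection \<Rightarrow>
   ('a \<Rightarrow> real ^ 'n) \<Rightarrow> ('a \<Rightarrow> real ^ 'n) \<Rightarrow> ('a \<Rightarrow> real ^ 'n) \<Rightarrow> 'a \<Rightarrow> real ^ 'n" where
  "curvature A nabla X Y Z p =
     cov nabla X (cov nabla Y Z) p - cov nabla Y (cov nabla X Z) p
       - cov nabla (lie_bracket A X Y) Z p"

text \<open>
  \<open>coord_field A c v\<close> is the vector field on the domain of \<open>c\<close> with constant components \<open>v\<close> in \<open>c\<close>.
  Since the curvature is tensorial, its value on tangent vectors at \<open>p\<close> can be computed
  with any extensions to vector fields near \<open>p\<close>; these are the ones used here.
\<close>

definition coord_field ::
  "('a, 'n::finite) atlas \<Rightarrow> ('a, 'n) chart \<Rightarrow> real ^ 'n \<Rightarrow> 'a \<Rightarrow> real ^ 'n" where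
  "coord_field A c v = (\<lambda>q. coord_change c (chart_at A q) q v)"

definition curvature_at ::
  "('a, 'n::finite) atlas \<Rightarrow> ('a, 'n) connection \<Rightarrow>
   'a \<Rightarrow> real ^ 'n \<Rightarrow> real ^ 'n \<Rightarrow> real ^ 'n \<Rightarrow> real ^ 'n" where
  "curvature_at A nabla p u v w =
     (let E = coord_field A (chart_at A p) in curvature A nabla (E u) (E v) (E w) p)"

definition ricci_tensor ::
  "('a, 'n::finite) atlas \<Rightarrow> ('a, 'n) connection \<Rightarrow> 'a \<Rightarrow> real ^ 'n \<Rightarrow> real ^ 'n \<Rightarrow> real" where
  "ricci_tensor A nabla p u v = trace (matrix (\<lambda>w. curvature_at A nabla p w u v))"

definition metric_trace ::
  "(real ^ 'n \<Rightarrow> real ^ 'n \<Rightarrow> real) \<Rightarrow> (real ^ 'n \<Rightarrow> real ^ 'n \<Rightarrow> real) \<Rightarrow> real" where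
  "metric_trace h B =
     (let G = (\<chi> i j. h (axis i 1) (axis j 1)) :: real ^ 'n ^ 'n in
        \<Sum>i\<in>UNIV. \<Sum>j\<in>UNIV. matrix_inv G $ i $ j * B (axis i 1) (axis j 1))"

definition scalar_curvature ::
  "('a, 'n::finite) atlas \<Rightarrow> ('a \<Rightarrow> real ^ 'n \<Rightarrow> real ^ 'n \<Rightarrow> real) \<Rightarrow> ('a, 'n) connection \<Rightarrow>
   'a \<Rightarrow> real" where
  "scalar_curvature A g nabla p = metric_trace (g p) (ricci_tensor A nabla p)"


section \<open>Para-Sasakian structures\<close>

definition almost_paracontact ::
  "('a::topological_space, 'n::finite) atlas \<Rightarrow> ('a \<Rightarrow> real ^ 'n \<Rightarrow> real ^ 'n) \<Rightarrow>
   ('a \<Rightarrow> real ^ 'n) \<Rightarrow> ('a \<Rightarrow> real ^ 'n \<Rightarrow> real) \<Rightarrow> bool" where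
  "almost_paracontact A \<phi> \<xi> \<eta> \<longleftrightarrow>
     endo_field A \<phi> \<and> vector_field_on A UNIV \<xi> \<and> one_form A \<eta> \<and>
     (\<forall>p. \<eta> p (\<xi> p) = 1) \<and>
     (\<forall>p v. \<phi> p (\<phi> p v) = v - \<eta> p v *\<^sub>R \<xi> p) \<and>
     (\<exists>m. CARD('n) = 2 * m + 1 \<and>
        (\<forall>p. dim {v. \<eta> p v = 0 \<and> \<phi> p v = v} = m \<and>
             dim {v. \<eta> p v = 0 \<and> \<phi> p v = - v} = m))"

definition almost_paracontact_metric ::
  "('a::topological_space, 'n::finite) atlas \<Rightarrow> ('a \<Rightarrow> real ^ 'n \<Rightarrow> real ^ 'n) \<Rightarrow>
   ('a \<Rightarrow> real ^ 'n) \<Rightarrow> ('a \<Rightarrow> real ^ 'n \<Rightarrow> real) \<Rightarrow>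
   ('a \<Rightarrow> real ^ 'n \<Rightarrow> real ^ 'n \<Rightarrow> real) \<Rightarrow> bool" where
  "almost_paracontact_metric A \<phi> \<xi> \<eta> g \<longleftrightarrow>
     almost_paracontact A \<phi> \<xi> \<eta> \<and> semi_riemannian_metric A g \<and>
     (\<forall>p u v. g p (\<phi> p u) (\<phi> p v) = - g p u v + \<eta> p u * \<eta> p v)"

definition fundamental_form ::
  "('a \<Rightarrow> real ^ 'n \<Rightarrow> real ^ 'n) \<Rightarrow> ('a \<Rightarrow> real ^ 'n \<Rightarrow> real ^ 'n \<Rightarrow> real) \<Rightarrow>
   'a \<Rightarrow> real ^ 'n \<Rightarrow> real ^ 'n \<Rightarrow> real" where
  "fundamental_form \<phi> g p u v = g p u (\<phi> p v)"

definition exterior_derivative ::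
  "('a, 'n::finite) atlas \<Rightarrow> ('a \<Rightarrow> real ^ 'n \<Rightarrow> real) \<Rightarrow>
   ('a \<Rightarrow> real ^ 'n) \<Rightarrow> ('a \<Rightarrow> real ^ 'n) \<Rightarrow> 'a \<Rightarrow> real" where
  "exterior_derivative A \<eta> X Y p =
     (differential A (\<lambda>q. \<eta> q (Y q)) p (X p) - differential A (\<lambda>q. \<eta> q (X q)) p (Y p)
       - \<eta> p (lie_bracket A X Y p)) / 2"

definition nijenhuis ::
  "('a, 'n::finite) atlas \<Rightarrow> ('a \<Rightarrow> real ^ 'n \<Rightarrow> real ^ 'n) \<Rightarrow>
   ('a \<Rightarrow> real ^ 'n) \<Rightarrow> ('a \<Rightarrow> real ^ 'n) \<Rightarrow> 'a \<Rightarrow> real ^ 'n" where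
  "nijenhuis A \<phi> X Y p =
     \<phi> p (\<phi> p (lie_bracket A X Y p))
       + lie_bracket A (\<lambda>q. \<phi> q (X q)) (\<lambda>q. \<phi> q (Y q)) p
       - \<phi> p (lie_bracket A (\<lambda>q. \<phi> q (X q)) Y p)
       - \<phi> p (lie_bracket A X (\<lambda>q. \<phi> q (Y q)) p)"

definition normal_structure ::
  "('a::topological_space, 'n::finite) atlas \<Rightarrow> ('a \<Rightarrow> real ^ 'n \<Rightarrow> real ^ 'n) \<Rightarrow>
   ('a \<Rightarrow> real ^ 'n) \<Rightarrow> ('a \<Rightarrow> real ^ 'n \<Rightarrow> real) \<Rightarrow> bool" where
  "normal_structure A \<phi> \<xi> \<eta> \<longleftrightarrow>
     (\<forall>W X Y. open W \<longrightarrow> vector_field_on A W X \<longrightarrow> vector_field_on A W Y \<longrightarrow>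
        (\<forall>p\<in>W. nijenhuis A \<phi> X Y p - (2 * exterior_derivative A \<eta> X Y p) *\<^sub>R \<xi> p = 0))"

definition paracontact_metric ::
  "('a::topological_space, 'n::finite) atlas \<Rightarrow> ('a \<Rightarrow> real ^ 'n \<Rightarrow> real ^ 'n) \<Rightarrow>
   ('a \<Rightarrow> real ^ 'n) \<Rightarrow> ('a \<Rightarrow> real ^ 'n \<Rightarrow> real) \<Rightarrow>
   ('a \<Rightarrow> real ^ 'n \<Rightarrow> real ^ 'n \<Rightarrow> real) \<Rightarrow> bool" where
  "paracontact_metric A \<phi> \<xi> \<eta> g \<longleftrightarrow>
     almost_paracontact_metric A \<phi> \<xi> \<eta> g \<and>
     (\<forall>W X Y. open W \<longrightarrow> vector_field_on A W X \<longrightarrow> vector_field_on A W Y \<longrightarrow>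
        (\<forall>p\<in>W. exterior_derivative A \<eta> X Y p = fundamental_form \<phi> g p (X p) (Y p)))"

definition para_sasakian ::
  "('a::topological_space, 'n::finite) atlas \<Rightarrow> ('a \<Rightarrow> real ^ 'n \<Rightarrow> real ^ 'n) \<Rightarrow>
   ('a \<Rightarrow> real ^ 'n) \<Rightarrow> ('a \<Rightarrow> real ^ 'n \<Rightarrow> real) \<Rightarrow>
   ('a \<Rightarrow> real ^ 'n \<Rightarrow> real ^ 'n \<Rightarrow> real) \<Rightarrow> bool" where
  "para_sasakian A \<phi> \<xi> \<eta> g \<longleftrightarrow>
     paracontact_metric A \<phi> \<xi> \<eta> g \<and> normal_structure A \<phi> \<xi> \<eta>"


section \<open>Solitons\<close>

text \<open>In both definitions \<open>nabla\<close> is meant to be the Levi-Civita connection of \<open>g\<close>.\<close>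

definition yamabe_soliton ::
  "('a::topological_space, 'n::finite) atlas \<Rightarrow> ('a \<Rightarrow> real ^ 'n \<Rightarrow> real ^ 'n \<Rightarrow> real) \<Rightarrow>
   ('a, 'n) connection \<Rightarrow> bool" where
  "yamabe_soliton A g nabla \<longleftrightarrow>
     (\<exists>V l. vector_field_on A UNIV V \<and>
        (\<forall>W X Y. open W \<longrightarrow> vector_field_on A W X \<longrightarrow> vector_field_on A W Y \<longrightarrow>
           (\<forall>p\<in>W. lie_derivative A V g X Y p =
              (l - scalar_curvature A g nabla p) * g p (X p) (Y p))))"

definition ricci_soliton ::
  "('a::topological_space, 'n::finite) atlas \<Rightarrow> ('a \<Rightarrow> real ^ 'n \<Rightarrow> real ^ 'n \<Rightarrow> real) \<Rightarrow>
   ('a, 'n) connection \<Rightarrow> bool" where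
  "ricci_soliton A g nabla \<longleftrightarrow>
     (\<exists>V \<mu>. vector_field_on A UNIV V \<and>
        (\<forall>W X Y. open W \<longrightarrow> vector_field_on A W X \<longrightarrow> vector_field_on A W Y \<longrightarrow>
           (\<forall>p\<in>W. lie_derivative A V g X Y p + 2 * ricci_tensor A nabla p (X p) (Y p)
              + 2 * \<mu> * g p (X p) (Y p) = 0)))"

end

theory Submission
  imports Defs
begin

text \<open>
  In dimension three the identities \<open>\<nabla>\<xi> = - \<phi>\<close> and
  \<open>(\<nabla>\<^sub>X \<phi>) Y = - g(X, Y) \<xi> + \<eta>(Y) X\<close> follow by linear algebra in a null frame
  \<open>\<xi>, e1, e2\<close> with \<open>\<phi> e1 = e1\<close>, \<open>\<phi> e2 = - e2\<close>, \<open>g(e1, e2) = 1\<close>, from \<open>d\<eta> = \<Phi>\<close>, \<open>d\<Phi> = 0\<close>, the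
  normality condition on pairs \<open>X, \<xi>\<close>, and the derivatives of \<open>g(\<xi>, \<xi>) = 1\<close>,
  \<open>\<phi>\<^sup>2 = I - \<eta> \<otimes> \<xi>\<close> and the skewness of \<open>\<phi>\<close>. Hence
  \<open>R(X, Y)\<xi> = \<eta>(X) Y - \<eta>(Y) X\<close>, so that up to curvature symmetries only the number
  \<open>k = g(R(e1, e2)e1, e2)\<close> remains free. The scalar curvature is \<open>2 k - 4\<close>; if it equals \<open>-6\<close>
  then \<open>k = -1\<close> and \<open>S = - 2 g\<close>, so a Yamabe soliton with constant \<open>\<lambda>\<close> is a Ricci
  soliton with the same vector field and \<open>\<mu> = - (\<lambda> + 2) / 2\<close>.
\<close>


section \<open>Calculus of smooth maps\<close>

text \<open>Openness of \<open>U\<close> makes equality on \<open>U\<close> an equality of germs, so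
  it passes to the Frechet derivatives and the induction goes through.\<close>

lemma Ck_on_cong:
  assumes "open U" "\<And>x. x \<in> U \<Longrightarrow> f x = f' x" "Ck_on k f U"
  shows "Ck_on k f' U"
  using assms(2,3)
proof (induction k arbitrary: f f')
  case 0
  then show ?case by (metis Ck_on.simps(1) continuous_on_cong)
next
  case (Suc k)
  have d: "(f' has_derivative frechet_derivative f (at x)) (at x)" if "x \<in> U" for x
    using Suc.prems that assms(1)
    by (metis Ck_on.simps(2) frechet_derivative_works has_derivative_transform_within_open)
  have e: "frechet_derivative f' (at x) = frechet_derivative f (at x)" if "x \<in> U" for x
    using frechet_derivative_at[OF d[OF that]] by simp
  show ?case
    unfolding Ck_on.simps
  proof (intro conjI ballI allI)
    show "f' differentiable at x" if "x \<in> U" for x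
      using d[OF that] differentiable_def by blast
    show "Ck_on k (\<lambda>x. frechet_derivative f' (at x) v) U" for v
      using Suc.IH[of "\<lambda>x. frechet_derivative f (at x) v"] Suc.prems(2) e by simp
  qed
qed

lemma Ck_on_subset: "Ck_on k f U \<Longrightarrow> V \<subseteq> U \<Longrightarrow> Ck_on k f V"
proof (induction k arbitrary: f)
  case 0
  then show ?case by (auto intro: continuous_on_subset)
qed auto

text \<open>The recursion for \<open>Suc k\<close> does not mention lower orders; they are recovered
  because differentiability implies continuity at the bottom level.\<close>

lemma Ck_on_Suc_imp: "Ck_on (Suc k) f U \<Longrightarrow> Ck_on k f U"
proof (induction k arbitrary: f)
  case 0
  then show ?case
    by (auto intro!: continuous_at_imp_continuous_on differentiable_imp_continuous_within)
next
  case (Suc k)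
  then show ?case by (metis Ck_on.simps(2))
qed

lemma Ck_on_const: "Ck_on k (\<lambda>x. c) U"
  by (induction k arbitrary: c) auto

lemma Ck_on_bounded_linear:
  assumes "open U" "bounded_linear h" "Ck_on k f U"
  shows "Ck_on k (\<lambda>x. h (f x)) U"
  using assms(3)
proof (induction k arbitrary: f)
  case 0
  then show ?case by (auto intro: bounded_linear.continuous_on[OF assms(2)])
next
  case (Suc k)
  have d: "((\<lambda>x. h (f x)) has_derivative (\<lambda>v. h (frechet_derivative f (at x) v))) (at x)"
    if "x \<in> U" for x
    using Suc.prems that
    by (intro bounded_linear.has_derivative[OF assms(2)]) (auto simp: frechet_derivative_works)
  have e: "frechet_derivative (\<lambda>x. h (f x)) (at x) = (\<lambda>v. h (frechet_derivative f (at x) v))"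
    if "x \<in> U" for x
    using frechet_derivative_at[OF d[OF that]] by simp
  show ?case
    unfolding Ck_on.simps
  proof (intro conjI ballI allI)
    show "(\<lambda>x. h (f x)) differentiable at x" if "x \<in> U" for x
      using d[OF that] differentiable_def by blast
    show "Ck_on k (\<lambda>x. frechet_derivative (\<lambda>x. h (f x)) (at x) v) U" for v
      by (rule Ck_on_cong[OF assms(1) _ Suc.IH]) (use Suc.prems e in auto)
  qed
qed

lemma Ck_on_add:
  assumes "open U" "Ck_on k f U" "Ck_on k g U"
  shows "Ck_on k (\<lambda>x. f x + g x) U"
  using assms(2,3)
proof (induction k arbitrary: f g)
  case 0
  then show ?case by (auto intro: continuous_on_add)
next
  case (Suc k)
  have d: "((\<lambda>x. f x + g x) has_derivative
      (\<lambda>v. frechet_derivative f (at x) v + frechet_derivative g (at x) v)) (at x)"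
    if "x \<in> U" for x
    using Suc.prems that
    by (intro has_derivative_add) (auto simp: frechet_derivative_works)
  have e: "frechet_derivative (\<lambda>x. f x + g x) (at x) =
      (\<lambda>v. frechet_derivative f (at x) v + frechet_derivative g (at x) v)"
    if "x \<in> U" for x
    using frechet_derivative_at[OF d[OF that]] by simp
  show ?case
    unfolding Ck_on.simps
  proof (intro conjI ballI allI)
    show "(\<lambda>x. f x + g x) differentiable at x" if "x \<in> U" for x
      using d[OF that] differentiable_def by blast
    show "Ck_on k (\<lambda>x. frechet_derivative (\<lambda>x. f x + g x) (at x) v) U" for v
      by (rule Ck_on_cong[OF assms(1) _ Suc.IH[of "\<lambda>x. frechet_derivative f (at x) v"
            "\<lambda>x. frechet_derivative g (at x) v"]]) (use Suc.prems e in auto)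
  qed
qed

lemma Ck_on_sum:
  assumes "open U" "finite I" "\<And>i. i \<in> I \<Longrightarrow> Ck_on k (f i) U"
  shows "Ck_on k (\<lambda>x. \<Sum>i\<in>I. f i x) U"
  using assms(2,3) by (induction I) (auto intro: Ck_on_const Ck_on_add[OF assms(1)])

lemma Ck_on_scaleR:
  assumes "open U" "Ck_on k f U" "Ck_on k g U"
  shows "Ck_on k (\<lambda>x. f x *\<^sub>R g x) U"
  using assms(2,3)
proof (induction k arbitrary: f g)
  case 0
  then show ?case by (auto intro: continuous_on_scaleR)
next
  case (Suc k)
  have d: "((\<lambda>x. f x *\<^sub>R g x) has_derivative
      (\<lambda>v. f x *\<^sub>R frechet_derivative g (at x) v + frechet_derivative f (at x) v *\<^sub>R g x)) (at x)"
    if "x \<in> U" for x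
    using Suc.prems that
    by (intro has_derivative_scaleR) (auto simp: frechet_derivative_works)
  have e: "frechet_derivative (\<lambda>x. f x *\<^sub>R g x) (at x) =
      (\<lambda>v. f x *\<^sub>R frechet_derivative g (at x) v + frechet_derivative f (at x) v *\<^sub>R g x)"
    if "x \<in> U" for x
    using frechet_derivative_at[OF d[OF that]] by simp
  show ?case
    unfolding Ck_on.simps
  proof (intro conjI ballI allI)
    show "(\<lambda>x. f x *\<^sub>R g x) differentiable at x" if "x \<in> U" for x
      using d[OF that] differentiable_def by blast
    fix v
    have "Ck_on k f U" "Ck_on k g U"
      using Suc.prems Ck_on_Suc_imp by auto
    then have "Ck_on k (\<lambda>x. f x *\<^sub>R frechet_derivative g (at x) v
        + frechet_derivative f (at x) v *\<^sub>R g x) U"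
      using Suc.prems by (intro Ck_on_add[OF assms(1)] Suc.IH) auto
    then show "Ck_on k (\<lambda>x. frechet_derivative (\<lambda>x. f x *\<^sub>R g x) (at x) v) U"
      by (rule Ck_on_cong[OF assms(1), rotated]) (simp add: e)
  qed
qed

lemma Ck_on_compose:
  fixes f :: "'b::euclidean_space \<Rightarrow> 'c::real_normed_vector"
    and g :: "'d::real_normed_vector \<Rightarrow> 'b"
  assumes "open U" "g ` U \<subseteq> V" "Ck_on k f V" "Ck_on k g U"
  shows "Ck_on k (\<lambda>x. f (g x)) U"
  using assms(3,4)
proof (induction k arbitrary: f)
  case 0
  then show ?case
    using assms(2) by (auto intro: continuous_on_compose2)
next
  case (Suc k)
  define f' where "f' y = frechet_derivative f (at y)" for y
  define g' where "g' x = frechet_derivative g (at x)" for x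
  have gd: "(g has_derivative g' x) (at x)" if "x \<in> U" for x
    using Suc.prems that by (auto simp: frechet_derivative_works g'_def)
  have fd: "(f has_derivative f' (g x)) (at (g x))" if "x \<in> U" for x
    using Suc.prems that assms(2) by (auto simp: frechet_derivative_works f'_def)
  have d: "((\<lambda>x. f (g x)) has_derivative (\<lambda>v. f' (g x) (g' x v))) (at x)" if "x \<in> U" for x
    using has_derivative_compose[OF gd[OF that] fd[OF that]] .
  \<comment> \<open>\<open>Ck_on\<close> only speaks of derivatives in a fixed direction, while
    \<open>g' x v\<close> moves with \<open>x\<close>. Expanding it in the basis leaves fixed
    directions \<open>b\<close> with C^k coefficients.\<close>
  have e: "frechet_derivative (\<lambda>x. f (g x)) (at x) v = (\<Sum>b\<in>Basis. (g' x v \<bullet> b) *\<^sub>R f' (g x) b)"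
    if "x \<in> U" for x v
  proof -
    have "linear (f' (g x))" using fd[OF that] has_derivative_linear by blast
    then have "f' (g x) (\<Sum>b\<in>Basis. (g' x v \<bullet> b) *\<^sub>R b) = (\<Sum>b\<in>Basis. (g' x v \<bullet> b) *\<^sub>R f' (g x) b)"
      by (simp add: linear_sum linear_scale)
    then show ?thesis
      using frechet_derivative_at[OF d[OF that], symmetric] by (simp add: euclidean_representation)
  qed
  show ?case
    unfolding Ck_on.simps
  proof (intro conjI ballI allI)
    show "(\<lambda>x. f (g x)) differentiable at x" if "x \<in> U" for x
      using d[OF that] differentiable_def by blast
    fix v
    have "Ck_on k g U" using Suc.prems Ck_on_Suc_imp by auto
    then have "Ck_on k (\<lambda>x. f' (g x) b) U" for b
      using Suc.IH[of "\<lambda>y. f' y b"] Suc.prems unfolding f'_def by auto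
    moreover have "Ck_on k (\<lambda>x. g' x v \<bullet> b) U" for b
      using Suc.prems unfolding g'_def
      by (intro Ck_on_bounded_linear[OF assms(1) bounded_linear_inner_left]) auto
    ultimately have "Ck_on k (\<lambda>x. \<Sum>b\<in>Basis. (g' x v \<bullet> b) *\<^sub>R f' (g x) b) U"
      by (intro Ck_on_sum Ck_on_scaleR assms(1)) auto
    then show "Ck_on k (\<lambda>x. frechet_derivative (\<lambda>x. f (g x)) (at x) v) U"
      by (rule Ck_on_cong[OF assms(1), rotated]) (simp add: e)
  qed
qed

lemma smooth_on_cong:
  "open U \<Longrightarrow> (\<And>x. x \<in> U \<Longrightarrow> f x = f' x) \<Longrightarrow> smooth_on f U \<Longrightarrow> smooth_on f' U"
  unfolding smooth_on_def using Ck_on_cong by metis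

lemma smooth_on_subset: "smooth_on f U \<Longrightarrow> V \<subseteq> U \<Longrightarrow> smooth_on f V"
  unfolding smooth_on_def using Ck_on_subset by blast

lemma smooth_on_const: "smooth_on (\<lambda>x. c) U"
  unfolding smooth_on_def using Ck_on_const by blast

lemma smooth_on_compose:
  fixes f :: "'b::euclidean_space \<Rightarrow> 'c::real_normed_vector"
  shows "open U \<Longrightarrow> g ` U \<subseteq> V \<Longrightarrow> smooth_on f V \<Longrightarrow> smooth_on g U \<Longrightarrow> smooth_on (\<lambda>x. f (g x)) U"
  unfolding smooth_on_def using Ck_on_compose by blast

lemma smooth_on_frechet_derivative:
  "smooth_on f U \<Longrightarrow> smooth_on (\<lambda>x. frechet_derivative f (at x) v) U"
  unfolding smooth_on_def by (metis Ck_on.simps(2))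

lemma smooth_on_has_derivative:
  "smooth_on f U \<Longrightarrow> x \<in> U \<Longrightarrow> (f has_derivative frechet_derivative f (at x)) (at x)"
  unfolding smooth_on_def by (metis Ck_on.simps(2) frechet_derivative_works)

lemma smooth_on_continuous: "smooth_on f U \<Longrightarrow> continuous_on U f"
  unfolding smooth_on_def by (metis Ck_on.simps(1))

section \<open>Symmetry of second derivatives\<close>

text \<open>Two applications of the mean value theorem, first along \<open>u\<close> and then along
  \<open>v\<close>, turn the second difference over a parallelogram into a mixed derivative at an
  interior point.\<close>

lemma mixed_difference_mvt:
  fixes f :: "'b::real_normed_vector \<Rightarrow> real"
  assumes "smooth_on f U" and h: "0 < h"
    and box: "\<And>s t. 0 \<le> s \<Longrightarrow> s \<le> h \<Longrightarrow> 0 \<le> t \<Longrightarrow> t \<le> h \<Longrightarrow> x + s *\<^sub>R u + t *\<^sub>R v \<in> U"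
  shows "\<exists>s t. 0 < s \<and> s < h \<and> 0 < t \<and> t < h \<and>
    f (x + h *\<^sub>R u + h *\<^sub>R v) - f (x + h *\<^sub>R u) - f (x + h *\<^sub>R v) + f x =
    h * (h * frechet_derivative (\<lambda>y. frechet_derivative f (at y) u) (at (x + s *\<^sub>R u + t *\<^sub>R v)) v)"
proof -
  define f' where "f' y = frechet_derivative f (at y)" for y
  define f'' where "f'' y = frechet_derivative (\<lambda>y. f' y u) (at y)" for y
  have d1: "((\<lambda>s. f (x + s *\<^sub>R u + t *\<^sub>R v)) has_real_derivative f' (x + s *\<^sub>R u + t *\<^sub>R v) u) (at s)"
    if "0 \<le> s" "s \<le> h" "0 \<le> t" "t \<le> h" for s t
  proof -
    let ?y = "x + s *\<^sub>R u + t *\<^sub>R v"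
    have f: "(f has_derivative f' ?y) (at ?y)"
      using smooth_on_has_derivative[OF assms(1) box[OF that]] unfolding f'_def .
    have "((\<lambda>s. x + s *\<^sub>R u + t *\<^sub>R v) has_derivative (\<lambda>r. r *\<^sub>R u)) (at s)"
      by (auto intro!: derivative_eq_intros)
    from has_derivative_compose[OF this f]
    have "((\<lambda>s. f (x + s *\<^sub>R u + t *\<^sub>R v)) has_derivative (\<lambda>r. f' ?y (r *\<^sub>R u))) (at s)" .
    then show ?thesis
      using has_derivative_linear[OF f]
      by (simp add: has_field_derivative_def linear_scale mult_commute_abs)
  qed
  have d2: "((\<lambda>t. f' (x + s *\<^sub>R u + t *\<^sub>R v) u) has_real_derivative f'' (x + s *\<^sub>R u + t *\<^sub>R v) v) (at t)"
    if "0 \<le> s" "s \<le> h" "0 \<le> t" "t \<le> h" for s t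
  proof -
    let ?y = "x + s *\<^sub>R u + t *\<^sub>R v"
    have f: "((\<lambda>y. f' y u) has_derivative f'' ?y) (at ?y)"
      using smooth_on_has_derivative[OF smooth_on_frechet_derivative[OF assms(1)] box[OF that]]
      unfolding f''_def f'_def .
    have "((\<lambda>t. x + s *\<^sub>R u + t *\<^sub>R v) has_derivative (\<lambda>r. r *\<^sub>R v)) (at t)"
      by (auto intro!: derivative_eq_intros)
    from has_derivative_compose[OF this f]
    have "((\<lambda>t. f' (x + s *\<^sub>R u + t *\<^sub>R v) u) has_derivative (\<lambda>r. f'' ?y (r *\<^sub>R v))) (at t)" .
    then show ?thesis
      using has_derivative_linear[OF f]
      by (simp add: has_field_derivative_def linear_scale mult_commute_abs)
  qed
  \<comment> \<open>The mean value theorem is applied to s -> f(x + s u + h v) - f(x + s u), whose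
    increment over [0, h] is the second difference.\<close>
  have "\<exists>s. 0 < s \<and> s < h \<and>
      (f (x + h *\<^sub>R u + h *\<^sub>R v) - f (x + h *\<^sub>R u + 0 *\<^sub>R v)) -
      (f (x + 0 *\<^sub>R u + h *\<^sub>R v) - f (x + 0 *\<^sub>R u + 0 *\<^sub>R v)) =
      (h - 0) * (f' (x + s *\<^sub>R u + h *\<^sub>R v) u - f' (x + s *\<^sub>R u + 0 *\<^sub>R v) u)"
    by (rule MVT2[OF h]) (intro DERIV_diff d1; use h in simp)
  then obtain s where s: "0 < s" "s < h"
    "(f (x + h *\<^sub>R u + h *\<^sub>R v) - f (x + h *\<^sub>R u)) - (f (x + h *\<^sub>R v) - f x) =
      h * (f' (x + s *\<^sub>R u + h *\<^sub>R v) u - f' (x + s *\<^sub>R u + 0 *\<^sub>R v) u)"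
    by auto
  have "\<exists>t. 0 < t \<and> t < h \<and> f' (x + s *\<^sub>R u + h *\<^sub>R v) u - f' (x + s *\<^sub>R u + 0 *\<^sub>R v) u =
      (h - 0) * f'' (x + s *\<^sub>R u + t *\<^sub>R v) v"
    by (rule MVT2[OF h]) (intro d2; use s in simp)
  then obtain t where t: "0 < t" "t < h" "f' (x + s *\<^sub>R u + h *\<^sub>R v) u - f' (x + s *\<^sub>R u + 0 *\<^sub>R v) u =
      h * f'' (x + s *\<^sub>R u + t *\<^sub>R v) v"
    by auto
  show ?thesis
    using s t unfolding f''_def f'_def by (intro exI[of _ s] exI[of _ t]) (simp add: algebra_simps)
qed

text \<open>The second difference is symmetric in \<open>u\<close> and \<open>v\<close>, so the two
  mixed derivatives agree at two possibly different points of a small parallelogram. Shrinking it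
  and using continuity at \<open>x\<close> gives equality there.\<close>

lemma second_derivative_symmetric_real:
  fixes f :: "'b::real_normed_vector \<Rightarrow> real"
  assumes "open U" "smooth_on f U" "x \<in> U"
  shows "frechet_derivative (\<lambda>y. frechet_derivative f (at y) u) (at x) v =
         frechet_derivative (\<lambda>y. frechet_derivative f (at y) v) (at x) u"
proof -
  define P where "P u v y = frechet_derivative (\<lambda>y. frechet_derivative f (at y) u) (at y) v" for u v y
  have cont: "isCont (P u v) x" for u v
    using smooth_on_continuous[OF smooth_on_frechet_derivative[OF smooth_on_frechet_derivative[OF assms(2)]]]
      assms(1,3) continuous_on_eq_continuous_at unfolding P_def by blast
  have "\<bar>P u v x - P v u x\<bar> \<le> e" if "e > 0" for e
  proof -
    have "e / 2 > 0" using that by simp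
    obtain r1 where r1: "r1 > 0" "\<And>y. dist y x < r1 \<Longrightarrow> \<bar>P u v y - P u v x\<bar> < e / 2"
      using cont[of u v] \<open>e / 2 > 0\<close> unfolding continuous_at_eps_delta dist_real_def by metis
    obtain r2 where r2: "r2 > 0" "\<And>y. dist y x < r2 \<Longrightarrow> \<bar>P v u y - P v u x\<bar> < e / 2"
      using cont[of v u] \<open>e / 2 > 0\<close> unfolding continuous_at_eps_delta dist_real_def by metis
    obtain r3 where r3: "r3 > 0" "\<And>y. dist y x < r3 \<Longrightarrow> y \<in> U"
      using assms(1,3) unfolding open_dist by metis
    define r where "r = min r1 (min r2 r3)"
    \<comment> \<open>This side length keeps the whole parallelogram within distance
      \<open>r\<close> of \<open>x\<close>; the summand 1 avoids division by zero when
      \<open>u\<close> and \<open>v\<close> both vanish.\<close>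
    define h where "h = r / (2 * (norm u + norm v + 1))"
    have r: "r > 0" using r1 r2 r3 r_def by auto
    have pos: "0 < norm u + norm v + 1" by (smt (verit) norm_ge_zero)
    then have h: "h > 0" using r h_def by auto
    have hr: "h * (norm u + norm v + 1) < r"
    proof -
      have "r / (2 * N) * N < r" if "N > 0" for N :: real
        using that r by simp
      then show ?thesis using pos unfolding h_def by blast
    qed
    have near: "dist (x + s *\<^sub>R a + t *\<^sub>R b) x < r"
      if "0 \<le> s" "s \<le> h" "0 \<le> t" "t \<le> h" "{a, b} = {u, v}" for s t a b
    proof -
      have "dist (x + s *\<^sub>R a + t *\<^sub>R b) x = norm (s *\<^sub>R a + t *\<^sub>R b)"
        by (simp add: dist_norm algebra_simps)
      also have "\<dots> \<le> s * norm a + t * norm b"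
        using norm_triangle_ineq[of "s *\<^sub>R a" "t *\<^sub>R b"] that by simp
      also have "\<dots> \<le> h * norm a + h * norm b"
        using that by (intro add_mono mult_right_mono) auto
      also have "\<dots> = h * (norm u + norm v)"
        using that(5) by (auto simp: doubleton_eq_iff algebra_simps)
      also have "\<dots> < r" using hr h by (simp add: algebra_simps)
      finally show ?thesis .
    qed
    have box: "x + s *\<^sub>R a + t *\<^sub>R b \<in> U"
      if "{a, b} = {u, v}" "0 \<le> s" "s \<le> h" "0 \<le> t" "t \<le> h" for s t a b
      using near[OF that(2-5,1)] by (intro r3(2)) (simp add: r_def)
    obtain s t where st: "0 < s" "s < h" "0 < t" "t < h"
      "f (x + h *\<^sub>R u + h *\<^sub>R v) - f (x + h *\<^sub>R u) - f (x + h *\<^sub>R v) + f x =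
        h * (h * P u v (x + s *\<^sub>R u + t *\<^sub>R v))"
      using mixed_difference_mvt[OF assms(2) h box[of u v]] unfolding P_def by auto
    obtain s' t' where st': "0 < s'" "s' < h" "0 < t'" "t' < h"
      "f (x + h *\<^sub>R v + h *\<^sub>R u) - f (x + h *\<^sub>R v) - f (x + h *\<^sub>R u) + f x =
        h * (h * P v u (x + s' *\<^sub>R v + t' *\<^sub>R u))"
      using mixed_difference_mvt[OF assms(2) h box[of v u]] unfolding P_def by auto
    have "h * (h * P u v (x + s *\<^sub>R u + t *\<^sub>R v)) = h * (h * P v u (x + s' *\<^sub>R v + t' *\<^sub>R u))"
      using st(5) st'(5) by (simp add: algebra_simps)
    then have "P u v (x + s *\<^sub>R u + t *\<^sub>R v) = P v u (x + s' *\<^sub>R v + t' *\<^sub>R u)"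
      using h by simp
    moreover have "\<bar>P u v (x + s *\<^sub>R u + t *\<^sub>R v) - P u v x\<bar> < e / 2"
      using near[of s t u v] st by (intro r1) (auto simp: r_def)
    moreover have "\<bar>P v u (x + s' *\<^sub>R v + t' *\<^sub>R u) - P v u x\<bar> < e / 2"
      using near[of s' t' v u] st' by (intro r2) (auto simp: r_def)
    ultimately show ?thesis by linarith
  qed
  then have "\<bar>P u v x - P v u x\<bar> \<le> 0"
    using field_le_epsilon[of "\<bar>P u v x - P v u x\<bar>" 0] by simp
  then show ?thesis unfolding P_def by simp
qed

text \<open>Pairing with each basis vector \<open>b\<close> commutes with both derivatives and
  reduces the claim to the real-valued case.\<close>

lemma second_derivative_symmetric:
  fixes f :: "'b::real_normed_vector \<Rightarrow> 'c::euclidean_space"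
  assumes "open U" "smooth_on f U" "x \<in> U"
  shows "frechet_derivative (\<lambda>y. frechet_derivative f (at y) u) (at x) v =
         frechet_derivative (\<lambda>y. frechet_derivative f (at y) v) (at x) u"
proof (rule euclidean_eqI)
  fix b :: 'c
  let ?fb = "\<lambda>y. f y \<bullet> b"
  have comp: "frechet_derivative (\<lambda>y. k y \<bullet> b) (at y) w = frechet_derivative k (at y) w \<bullet> b"
    if "smooth_on k U" "y \<in> U" for y w and k :: "'b \<Rightarrow> 'c"
    using frechet_derivative_at[OF has_derivative_inner_left[OF smooth_on_has_derivative[OF that]]]
    by metis
  have eq: "frechet_derivative (\<lambda>y. frechet_derivative ?fb (at y) w) (at x) w' =
      frechet_derivative (\<lambda>y. frechet_derivative f (at y) w) (at x) w' \<bullet> b" for w w'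
  proof -
    have sm: "smooth_on (\<lambda>y. frechet_derivative f (at y) w) U"
      by (rule smooth_on_frechet_derivative[OF assms(2)])
    have "((\<lambda>y. frechet_derivative ?fb (at y) w) has_derivative
       (\<lambda>w'. frechet_derivative (\<lambda>y. frechet_derivative f (at y) w) (at x) w' \<bullet> b)) (at x)"
      by (rule has_derivative_transform_within_open[OF
            has_derivative_inner_left[OF smooth_on_has_derivative[OF sm assms(3)]] assms(1,3)])
        (simp add: comp[OF assms(2)])
    from frechet_derivative_at[OF this] show ?thesis by metis
  qed
  have "smooth_on ?fb U"
    using assms(1,2) Ck_on_bounded_linear[OF _ bounded_linear_inner_left]
    unfolding smooth_on_def by blast
  from second_derivative_symmetric_real[OF assms(1) this assms(3)]
  show "frechet_derivative (\<lambda>y. frechet_derivative f (at y) u) (at x) v \<bullet> b =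
      frechet_derivative (\<lambda>y. frechet_derivative f (at y) v) (at x) u \<bullet> b"
    using eq by simp
qed


section \<open>Three-dimensional paracontact linear algebra\<close>

text \<open>The structure on a single tangent space. Dimension three makes both eigenspaces of
  \<open>\<phi>\<close> in the kernel of \<open>\<eta>\<close> into lines.\<close>

locale paracontact_space =
  fixes g :: "real ^ 3 \<Rightarrow> real ^ 3 \<Rightarrow> real"
    and \<phi> :: "real ^ 3 \<Rightarrow> real ^ 3"
    and \<xi> :: "real ^ 3"
    and \<eta> :: "real ^ 3 \<Rightarrow> real"
  assumes g_bilinear: "bilinear g"
    and g_sym: "g u v = g v u"
    and g_nondegenerate: "(\<And>v. g u v = 0) \<Longrightarrow> u = 0"
    and phi_linear: "linear \<phi>"
    and eta_linear: "linear \<eta>"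
    and eta_xi [simp]: "\<eta> \<xi> = 1"
    and phi_phi: "\<phi> (\<phi> v) = v - \<eta> v *\<^sub>R \<xi>"
    and dim_plus: "dim {v. \<eta> v = 0 \<and> \<phi> v = v} = 1"
    and dim_minus: "dim {v. \<eta> v = 0 \<and> \<phi> v = - v} = 1"
    and g_phi_phi: "g (\<phi> u) (\<phi> v) = - g u v + \<eta> u * \<eta> v"
begin

lemmas phi_simps = linear_add[OF phi_linear] linear_diff[OF phi_linear] linear_scale[OF phi_linear]
  linear_neg[OF phi_linear] linear_0[OF phi_linear]
lemmas eta_simps = linear_add[OF eta_linear] linear_diff[OF eta_linear] linear_scale[OF eta_linear]
  linear_neg[OF eta_linear] linear_0[OF eta_linear]
lemmas g_simps = bilinear_ladd[OF g_bilinear] bilinear_radd[OF g_bilinear]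
  bilinear_lmul[OF g_bilinear] bilinear_rmul[OF g_bilinear]
  bilinear_lneg[OF g_bilinear] bilinear_rneg[OF g_bilinear]
  bilinear_lsub[OF g_bilinear] bilinear_rsub[OF g_bilinear]
  bilinear_lzero[OF g_bilinear] bilinear_rzero[OF g_bilinear]

lemma g_eqI: "(\<And>z. g u z = g v z) \<Longrightarrow> u = v"
  using g_nondegenerate[of "u - v"] by (simp add: g_simps)

text \<open>Since \<open>\<phi> (\<phi> \<xi>)\<close> vanishes, the formula for the square of
  \<open>\<phi>\<close> at \<open>\<phi> \<xi>\<close> makes \<open>\<phi> \<xi>\<close> a multiple
  of \<open>\<xi>\<close>; applying \<open>\<phi>\<close> once more shows that the multiple is
  zero.\<close>

lemma phi_xi [simp]: "\<phi> \<xi> = 0"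
proof -
  have 0: "\<phi> (\<phi> \<xi>) = 0" by (simp add: phi_phi)
  then have eq: "\<phi> \<xi> = \<eta> (\<phi> \<xi>) *\<^sub>R \<xi>"
    using phi_phi[of "\<phi> \<xi>"] by (simp add: phi_simps)
  then have "\<eta> (\<phi> \<xi>) *\<^sub>R \<phi> \<xi> = 0" using 0 by (metis phi_simps(3))
  then show ?thesis using eq by (metis scaleR_eq_0_iff)
qed

text \<open>The cube of \<open>\<phi>\<close> is evaluated in two ways, with the square formula
  applied inside and outside.\<close>

lemma eta_phi [simp]: "\<eta> (\<phi> v) = 0"
proof -
  have "\<phi> v = \<phi> v - \<eta> (\<phi> v) *\<^sub>R \<xi>"
    using phi_phi[of "\<phi> v"] by (simp add: phi_phi phi_simps)
  then have "\<eta> (\<phi> v) *\<^sub>R \<xi> = 0" by simp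
  then show ?thesis using eta_xi eta_simps(5) by (metis scaleR_eq_0_iff zero_neq_one)
qed

lemma g_xi_right: "g u \<xi> = \<eta> u"
  using g_phi_phi[of u \<xi>] by (simp add: g_simps)

lemma g_xi_left: "g \<xi> u = \<eta> u"
  using g_xi_right[of u] g_sym[of u] by simp

lemma g_phi_left: "g (\<phi> u) v = - g u (\<phi> v)"
  using g_phi_phi[of u "\<phi> v"] by (simp add: phi_phi g_simps g_xi_right)

text \<open>Skewness moves \<open>T\<close> onto the test vector, where additivity of
  \<open>g\<close> applies, and nondegeneracy removes the test vector. It yields linearity of the
  curvature and of the derivative of \<open>\<phi>\<close> in their last slots.\<close>

lemma linear_of_skew:
  assumes "\<And>u v. g (T u) v = - g u (T v)"
  shows "linear T"
  by (rule linearI; rule g_eqI) (simp_all add: assms g_simps)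

end

lemma matrix_inv_eqI:
  fixes M H :: "real ^ 'n ^ 'n"
  assumes "M ** H = mat 1"
  shows "matrix_inv M = H"
proof -
  have H: "H ** M = mat 1" using assms by (simp add: matrix_left_right_inverse)
  then have "\<exists>H. M ** H = mat 1 \<and> H ** M = mat 1" using assms by blast
  from someI_ex[OF this] have "M ** matrix_inv M = mat 1"
    unfolding matrix_inv_def by blast
  then have "H = H ** (M ** matrix_inv M)" by simp
  also have "\<dots> = matrix_inv M" by (simp add: matrix_mul_assoc H)
  finally show ?thesis by simp
qed

lemma dim_eq_1_span:
  assumes "subspace S" "dim S = 1"
  shows "\<exists>e. e \<in> S \<and> e \<noteq> 0 \<and> (\<forall>v\<in>S. \<exists>a. v = a *\<^sub>R e)"
proof -
  obtain b where b: "b \<subseteq> S" "independent b" "S \<subseteq> span b" "card b = 1"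
    using basis_exists[of S] assms(2) by metis
  then obtain e where e: "b = {e}" using card_1_singletonE by blast
  then have "e \<noteq> 0" using b(2) dependent_zero by blast
  then show ?thesis using b e by (auto simp: span_singleton)
qed

section \<open>Null frames and traces\<close>

text \<open>\<open>frame_expand\<close> says that the frame \<open>\<xi>\<close>, \<open>e1\<close>,
  \<open>e2\<close> has dual frame \<open>\<eta>\<close>, g(., \<open>e2\<close>), g(.,
  \<open>e1\<close>): the two null vectors are swapped in passing to the dual.\<close>

locale null_frame = paracontact_space +
  fixes e1 e2 :: "real ^ 3"
  assumes phi_e1 [simp]: "\<phi> e1 = e1" and phi_e2 [simp]: "\<phi> e2 = - e2"
    and eta_e1 [simp]: "\<eta> e1 = 0" and eta_e2 [simp]: "\<eta> e2 = 0"
    and g_e1_e2 [simp]: "g e1 e2 = 1"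
    and frame_expand: "v = \<eta> v *\<^sub>R \<xi> + g v e2 *\<^sub>R e1 + g v e1 *\<^sub>R e2"

text \<open>Vectors \<open>e\<close> and \<open>f\<close> spanning the two eigenlines are null,
  because \<open>\<phi>\<close> preserves them up to sign and reverses \<open>g\<close> on the
  kernel of \<open>\<eta>\<close>. Nondegeneracy then forces \<open>g e f\<close> to be nonzero, and
  \<open>f\<close> is rescaled.\<close>

lemma (in paracontact_space) null_frame_exists: "\<exists>e1 e2. null_frame g \<phi> \<xi> \<eta> e1 e2"
proof -
  let ?P = "{v. \<eta> v = 0 \<and> \<phi> v = v}" and ?M = "{v. \<eta> v = 0 \<and> \<phi> v = - v}"
  have sub: "subspace ?P" "subspace ?M"
    by (auto simp: subspace_def phi_simps eta_simps)
  obtain e where e: "e \<in> ?P" "\<And>v. v \<in> ?P \<Longrightarrow> \<exists>a. v = a *\<^sub>R e" "e \<noteq> 0"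
    using dim_eq_1_span[OF sub(1) dim_plus] by blast
  obtain f where f: "f \<in> ?M" "\<And>v. v \<in> ?M \<Longrightarrow> \<exists>a. v = a *\<^sub>R f" "f \<noteq> 0"
    using dim_eq_1_span[OF sub(2) dim_minus] by blast
  have ex: "\<exists>a b. v = \<eta> v *\<^sub>R \<xi> + a *\<^sub>R e + b *\<^sub>R f" for v
  proof -
    \<comment> \<open>These are the projections of \<open>v - \<eta> v *\<^sub>R \<xi>\<close> to
      the eigenlines for 1 and -1.\<close>
    let ?p = "(1/2) *\<^sub>R (\<phi> (\<phi> v) + \<phi> v)" and ?m = "(1/2) *\<^sub>R (\<phi> (\<phi> v) - \<phi> v)"
    have ppp: "\<phi> (\<phi> (\<phi> v)) = \<phi> v" by (simp add: phi_phi phi_simps)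
    have "?p \<in> ?P" "?m \<in> ?M"
      by (simp_all add: phi_simps eta_simps ppp algebra_simps)
    then obtain a b where ab: "?p = a *\<^sub>R e" "?m = b *\<^sub>R f" using e(2) f(2) by blast
    have "v = \<eta> v *\<^sub>R \<xi> + ?p + ?m"
    proof -
      have "?p + ?m = \<phi> (\<phi> v)"
        using scaleR_half_double[of "\<phi> (\<phi> v)"]
        by (simp add: scaleR_right_distrib scaleR_right_diff_distrib)
      then show ?thesis by (metis add.assoc add.commute diff_add_cancel phi_phi)
    qed
    then show ?thesis unfolding ab by blast
  qed
  have ee: "g e e = 0" and ff: "g f f = 0"
    using g_phi_phi[of e e] g_phi_phi[of f f] e(1) f(1) by (auto simp: g_simps)
  have ef: "g e f \<noteq> 0"
  proof
    assume 0: "g e f = 0"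
    have "g e v = 0" for v
    proof -
      obtain a b where "v = \<eta> v *\<^sub>R \<xi> + a *\<^sub>R e + b *\<^sub>R f" using ex by blast
      then have "g e v = g e (\<eta> v *\<^sub>R \<xi> + a *\<^sub>R e + b *\<^sub>R f)" by simp
      then show ?thesis using 0 ee e(1) by (simp add: g_simps g_xi_right)
    qed
    then show False using g_nondegenerate e(3) by blast
  qed
  define e2 where "e2 = (1 / g e f) *\<^sub>R f"
  have "null_frame g \<phi> \<xi> \<eta> e e2"
  proof
    show "\<phi> e = e" "\<phi> e2 = - e2" "\<eta> e = 0" "\<eta> e2 = 0" "g e e2 = 1"
      using e f ef by (simp_all add: e2_def phi_simps eta_simps g_simps)
    fix v
    obtain a b where v: "v = \<eta> v *\<^sub>R \<xi> + a *\<^sub>R e + b *\<^sub>R f" using ex by blast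
    have "g v e2 = g (\<eta> v *\<^sub>R \<xi> + a *\<^sub>R e + b *\<^sub>R f) e2" using v by simp
    then have a: "g v e2 = a"
      using ee ff ef e(1) f(1) g_sym[of f e] by (simp add: e2_def g_simps g_xi_left)
    have "g v e = g (\<eta> v *\<^sub>R \<xi> + a *\<^sub>R e + b *\<^sub>R f) e" using v by simp
    then have b: "g v e = b * g e f"
      using ee ff ef e(1) f(1) g_sym[of f e] by (simp add: g_simps g_xi_left)
    show "v = \<eta> v *\<^sub>R \<xi> + g v e2 *\<^sub>R e + g v e *\<^sub>R e2"
      unfolding a b using v ef by (simp add: e2_def)
  qed
  then show ?thesis by blast
qed

context null_frame
begin

lemma g_frame [simp]: "g e1 e1 = 0" "g e2 e2 = 0" "g e2 e1 = 1"
  "g \<xi> v = \<eta> v" "g v \<xi> = \<eta> v"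
  using g_phi_phi[of e1 e1] g_phi_phi[of e2 e2] g_sym[of e2 e1]
  by (auto simp: g_simps g_xi_left g_xi_right)

lemma frame_eqI: "\<eta> u = \<eta> v \<Longrightarrow> g u e1 = g v e1 \<Longrightarrow> g u e2 = g v e2 \<Longrightarrow> u = v"
  using frame_expand[of u] frame_expand[of v] by simp

lemma linear_frame:
  assumes "linear T"
  shows "T v = \<eta> v *\<^sub>R T \<xi> + g v e2 *\<^sub>R T e1 + g v e1 *\<^sub>R T e2"
proof -
  have "T v = T (\<eta> v *\<^sub>R \<xi> + g v e2 *\<^sub>R e1 + g v e1 *\<^sub>R e2)"
    using frame_expand[of v] by simp
  then show ?thesis by (simp add: linear_add[OF assms] linear_scale[OF assms])
qed

lemma linear_frame_eqI:
  assumes "linear T" "linear T'" "T \<xi> = T' \<xi>" "T e1 = T' e1" "T e2 = T' e2"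
  shows "T v = T' v"
  using linear_frame[OF assms(1), of v] linear_frame[OF assms(2), of v] assms(3-5) by simp

text \<open>This absorbs sums over the standard basis, in which traces are defined, into values of
  \<open>g\<close>.\<close>

lemma sum_g_axis:
  "(\<Sum>i\<in>UNIV. g (axis i 1) w * x $ i) = g x w"
proof -
  have "x = (\<Sum>i\<in>UNIV. x $ i *\<^sub>R axis i 1)"
    using basis_expansion[of x] by (simp add: scalar_mult_eq_scaleR)
  then have "g x w = g (\<Sum>i\<in>UNIV. x $ i *\<^sub>R axis i 1) w" by simp
  also have "\<dots> = (\<Sum>i\<in>UNIV. g (x $ i *\<^sub>R axis i 1) w)"
    using g_bilinear by (intro linear_sum) (simp add: bilinear_def)
  finally show ?thesis by (simp add: g_simps mult.commute)
qed

text \<open>Each \<open>T (axis i 1)\<close> is expanded through the frame, and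
  \<open>sum_g_axis\<close> collapses the sum over \<open>i\<close>.\<close>

lemma trace_frame:
  assumes "linear T"
  shows "trace (matrix T) = \<eta> (T \<xi>) + g (T e1) e2 + g (T e2) e1"
proof -
  have "trace (matrix T) = (\<Sum>i\<in>UNIV. T (axis i 1) $ i)"
    by (simp add: trace_def matrix_def)
  also have "\<dots> = (\<Sum>i\<in>UNIV. g (axis i 1) \<xi> * T \<xi> $ i + g (axis i 1) e2 * T e1 $ i
      + g (axis i 1) e1 * T e2 $ i)"
    by (subst linear_frame[OF assms]) simp
  also have "\<dots> = g (T \<xi>) \<xi> + g (T e1) e2 + g (T e2) e1"
    by (simp only: sum.distrib sum_g_axis)
  finally show ?thesis by simp
qed

lemma metric_trace_frame:
  assumes "bilinear B"
  shows "metric_trace g B = B \<xi> \<xi> + B e1 e2 + B e2 e1"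
proof -
  let ?G = "(\<chi> i j. g (axis i 1) (axis j 1)) :: real ^ 3 ^ 3"
  \<comment> \<open>The inverse metric in the null frame: \<open>\<xi>\<close> paired with itself
    and \<open>e1\<close> paired with \<open>e2\<close>. That it inverts the Gram matrix is
    \<open>frame_expand\<close> read on the standard basis vectors.\<close>
  let ?H = "(\<chi> i j. \<xi> $ i * \<xi> $ j + e1 $ i * e2 $ j + e2 $ i * e1 $ j) :: real ^ 3 ^ 3"
  have "?G ** ?H = mat 1"
  proof -
    have "(?G ** ?H) $ i $ k = (mat 1 :: real ^ 3 ^ 3) $ i $ k" for i k
    proof -
      have "(?G ** ?H) $ i $ k = (\<Sum>j\<in>UNIV. g (axis j 1) (axis i 1) * \<xi> $ j) * \<xi> $ k
        + (\<Sum>j\<in>UNIV. g (axis j 1) (axis i 1) * e1 $ j) * e2 $ k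
        + (\<Sum>j\<in>UNIV. g (axis j 1) (axis i 1) * e2 $ j) * e1 $ k"
        unfolding matrix_matrix_mult_def
        by (simp add: g_sym[of "axis i 1"] sum_distrib_left sum_distrib_right sum.distrib algebra_simps)
      also have "\<dots> = (\<eta> (axis i 1) *\<^sub>R \<xi> + g (axis i 1) e2 *\<^sub>R e1 + g (axis i 1) e1 *\<^sub>R e2) $ k"
        unfolding sum_g_axis by (simp add: g_sym[of _ "axis i 1"])
      also have "\<dots> = axis i 1 $ k" using frame_expand[of "axis i 1"] by simp
      finally show ?thesis by (simp add: mat_def axis_def)
    qed
    then show ?thesis by (simp add: vec_eq_iff)
  qed
  then have "matrix_inv ?G = ?H"
    by (rule matrix_inv_eqI)
  then have "metric_trace g B = (\<Sum>i\<in>UNIV. \<Sum>j\<in>UNIV.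
      (\<xi> $ i * \<xi> $ j + e1 $ i * e2 $ j + e2 $ i * e1 $ j) * B (axis i 1) (axis j 1))"
    unfolding metric_trace_def Let_def by simp
  also have "\<dots> = (\<Sum>i\<in>UNIV. \<Sum>j\<in>UNIV. \<xi> $ i * \<xi> $ j * B (axis i 1) (axis j 1))
     + (\<Sum>i\<in>UNIV. \<Sum>j\<in>UNIV. e1 $ i * e2 $ j * B (axis i 1) (axis j 1))
     + (\<Sum>i\<in>UNIV. \<Sum>j\<in>UNIV. e2 $ i * e1 $ j * B (axis i 1) (axis j 1))"
    by (simp add: sum.distrib algebra_simps)
  also have "\<dots> = B \<xi> \<xi> + B e1 e2 + B e2 e1"
  proof -
    have "(\<Sum>i\<in>UNIV. \<Sum>j\<in>UNIV. x $ i * y $ j * B (axis i 1) (axis j 1)) = B x y" for x y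
    proof -
      have x: "x = (\<Sum>i\<in>UNIV. x $ i *\<^sub>R axis i 1)" for x :: "real ^ 3"
        using basis_expansion[of x] by (simp add: scalar_mult_eq_scaleR)
      have "B x y = B (\<Sum>i\<in>UNIV. x $ i *\<^sub>R axis i 1) (\<Sum>j\<in>UNIV. y $ j *\<^sub>R axis j 1)"
        using x[of x] x[of y] by simp
      also have "\<dots> = (\<Sum>(i, j)\<in>UNIV \<times> UNIV. B (x $ i *\<^sub>R axis i 1) (y $ j *\<^sub>R axis j 1))"
        by (rule bilinear_sum[OF assms])
      also have "\<dots> = (\<Sum>i\<in>UNIV. \<Sum>j\<in>UNIV. x $ i * y $ j * B (axis i 1) (axis j 1))"
        by (simp add: sum.cartesian_product bilinear_lmul[OF assms] bilinear_rmul[OF assms] mult_ac)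
      finally show ?thesis by simp
    qed
    then show ?thesis by simp
  qed
  finally show ?thesis .
qed

section \<open>Pointwise determination of the derivatives of the structure tensors\<close>

text \<open>
  Here \<open>B u\<close> and \<open>D u v\<close> stand for the values of \<open>\<nabla>\<^sub>u \<xi>\<close> and \<open>(\<nabla>\<^sub>u \<phi>) v\<close> at a point.
\<close>

lemma reeb_derivative_eq:
  assumes B: "linear B"
    and C: "\<And>u v. g (B u) v - g (B v) u = 2 * g u (\<phi> v)"
    and U: "\<And>u. \<eta> (B u) = 0"
    and N: "\<And>u. \<phi> (\<phi> (B u) - B (\<phi> u) + D \<xi> u) = 0"
    and S: "\<And>u v w. g (D u v) w = - g v (D u w)"
    and Q: "\<And>u v. D u (\<phi> v) + \<phi> (D u v) = - g v (B u) *\<^sub>R \<xi> - \<eta> v *\<^sub>R B u"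
    and X: "\<And>u. D u \<xi> = - \<phi> (B u)"
    and P: "\<And>u v w. g u (D w v) + g v (D u w) + g w (D v u) = 0"
  shows "B u = - \<phi> u"
proof -
  \<comment> \<open>The curves of \<open>\<xi>\<close> are geodesics: in \<open>C\<close> at
    \<open>\<xi>\<close> every other term vanishes, since \<open>\<eta>\<close> kills the images of
    both \<open>B\<close> and \<open>\<phi>\<close>.\<close>
  have Bxi: "B \<xi> = 0"
  proof (rule g_nondegenerate)
    show "g (B \<xi>) v = 0" for v using C[of \<xi> v] U[of v] by simp
  qed
  have lin: "linear (D u)" for u by (rule linear_of_skew) (rule S)
  \<comment> \<open>The \<eta>-component vanishes by \<open>S\<close> and \<open>X\<close>, the
    diagonal one by skewness alone, and the remaining one by \<open>Q\<close>, where the two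
    summands on the left contribute equally.\<close>
  have Dxi: "D \<xi> e1 = 0" "D \<xi> e2 = 0"
  proof -
    have "\<eta> (D \<xi> e1) = 0" "\<eta> (D \<xi> e2) = 0"
      using S[of \<xi> e1 \<xi>] S[of \<xi> e2 \<xi>] by (simp_all add: X Bxi phi_simps g_simps)
    moreover have "g (D \<xi> e1) e1 = 0" "g (D \<xi> e2) e2 = 0"
      using S[of \<xi> e1 e1] S[of \<xi> e2 e2] g_sym[of e1 "D \<xi> e1"] g_sym[of e2 "D \<xi> e2"] by linarith+
    moreover have "g (D \<xi> e1 + \<phi> (D \<xi> e1)) e2 = 0"
      using Q[of \<xi> e1] by (simp add: Bxi g_simps)
    then have "g (D \<xi> e1) e2 = 0" by (simp add: g_simps g_phi_left)
    moreover have "g (- D \<xi> e2 + \<phi> (D \<xi> e2)) e1 = 0"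
      using Q[of \<xi> e2] by (simp add: Bxi g_simps linear_neg[OF lin])
    then have "g (D \<xi> e2) e1 = 0" by (simp add: g_simps g_phi_left)
    ultimately show "D \<xi> e1 = 0" "D \<xi> e2 = 0"
      by (auto intro!: frame_eqI simp: g_simps eta_simps)
  qed
  \<comment> \<open>Pairing the normality identity with an eigenvector turns each
    \<open>\<phi>\<close> into a sign, and the two terms add up instead of cancelling.\<close>
  have "g (\<phi> (\<phi> (B e1) - B e1)) e1 = 0"
    using N[of e1] Dxi by (simp add: g_simps)
  then have B11: "g (B e1) e1 = 0" by (simp add: g_simps g_phi_left)
  have "g (\<phi> (\<phi> (B e2) + B e2)) e2 = 0"
    using N[of e2] Dxi by (simp add: g_simps linear_neg[OF B])
  then have B22: "g (B e2) e2 = 0" by (simp add: g_simps g_phi_left)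
  have "g (B e1) e2 - g (B e2) e1 = -2" using C[of e1 e2] by (simp add: g_simps)
  \<comment> \<open>Closedness of the fundamental form, on \<open>e1\<close>, \<open>e2\<close>,
    \<open>\<xi>\<close>, supplies the sum of the off-diagonal entries; their difference comes from
    \<open>C\<close>.\<close>
  moreover have "g (B e1) e2 + g (B e2) e1 = 0"
  proof -
    have "g e1 (D \<xi> e2) + g e2 (D e1 \<xi>) + g \<xi> (D e2 e1) = 0" by (rule P)
    moreover have "\<eta> (D e2 e1) = g e1 (\<phi> (B e2))"
      using S[of e2 e1 \<xi>] by (simp add: X g_simps)
    moreover have "g e1 (\<phi> (B e2)) = - g (B e2) e1" "g e2 (\<phi> (B e1)) = g (B e1) e2"
      using g_phi_left[of e1 "B e2"] g_phi_left[of e2 "B e1"]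
        g_sym[of e1 "B e2"] g_sym[of e2 "B e1"] by (simp_all add: g_simps)
    ultimately show ?thesis by (simp add: Dxi X g_simps)
  qed
  ultimately have B12: "g (B e1) e2 = -1" "g (B e2) e1 = 1" by linarith+
  have "B e1 = - e1" "B e2 = e2"
    by (rule frame_eqI; simp add: U B11 B22 B12 g_simps eta_simps)+
  then show ?thesis
    using linear_frame_eqI[OF B, of "\<lambda>u. - \<phi> u" u] phi_linear Bxi
    by (simp add: linear_compose_neg)
qed

text \<open>\<open>Q\<close> and \<open>X\<close> are the earlier identities after inserting
  \<nabla>\<xi> = -\<phi>. On \<open>e1\<close> and \<open>e2\<close>, \<open>S\<close> with
  \<open>X\<close> gives the \<eta>-component, skewness kills the diagonal one and \<open>Q\<close>
  the other; the value on \<open>\<xi>\<close> is \<open>X\<close>.\<close>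

lemma phi_derivative_eq:
  assumes S: "\<And>u v w. g (D u v) w = - g v (D u w)"
    and Q: "\<And>u v. D u (\<phi> v) + \<phi> (D u v) = g v (\<phi> u) *\<^sub>R \<xi> + \<eta> v *\<^sub>R \<phi> u"
    and X: "\<And>u. D u \<xi> = \<phi> (\<phi> u)"
  shows "D u v = - g u v *\<^sub>R \<xi> + \<eta> v *\<^sub>R u"
proof -
  have lin: "linear (D u)" by (rule linear_of_skew) (rule S)
  have "\<eta> (D u e1) = - g u e1" "\<eta> (D u e2) = - g u e2"
    using S[of u e1 \<xi>] S[of u e2 \<xi>] by (simp_all add: X phi_phi g_simps g_sym[of u])
  moreover have "g (D u e1) e1 = 0" "g (D u e2) e2 = 0"
    using S[of u e1 e1] S[of u e2 e2] g_sym[of e1 "D u e1"] g_sym[of e2 "D u e2"] by linarith+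
  moreover have "g (D u e1 + \<phi> (D u e1)) e2 = 0"
    using Q[of u e1] by (simp add: g_simps)
  then have "g (D u e1) e2 = 0" by (simp add: g_simps g_phi_left)
  moreover have "g (- D u e2 + \<phi> (D u e2)) e1 = 0"
    using Q[of u e2] by (simp add: g_simps linear_neg[OF lin])
  then have "g (D u e2) e1 = 0" by (simp add: g_simps g_phi_left)
  ultimately have "D u e1 = - g u e1 *\<^sub>R \<xi>" "D u e2 = - g u e2 *\<^sub>R \<xi>"
    by (auto intro!: frame_eqI simp: g_simps eta_simps)
  moreover have "linear (\<lambda>v. - g u v *\<^sub>R \<xi> + \<eta> v *\<^sub>R u)"
    by (rule linearI) (simp_all add: g_simps eta_simps algebra_simps)
  ultimately show ?thesis
    using linear_frame_eqI[OF lin, of "\<lambda>v. - g u v *\<^sub>R \<xi> + \<eta> v *\<^sub>R u" v] X[of u]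
    by (simp add: phi_phi)
qed

end

section \<open>Algebraic curvature and the Ricci tensor\<close>

locale curvature_like = paracontact_space +
  fixes R :: "real ^ 3 \<Rightarrow> real ^ 3 \<Rightarrow> real ^ 3 \<Rightarrow> real ^ 3"
  assumes R_skew: "R u v w = - R v u w"
    and R_bianchi: "R u v w + R v w u + R w u v = 0"
    and R_metric: "g (R u v w) z = - g w (R u v z)"
    and R_xi: "R u v \<xi> = \<eta> u *\<^sub>R v - \<eta> v *\<^sub>R u"
begin

text \<open>The classical argument: four instances of the Bianchi identity are combined, and the
  skew symmetries in the first and last pairs cancel the unwanted terms.\<close>

lemma R_pair_symmetry: "g (R u v w) z = g (R w z u) v"
proof -
  define k where "k u v w z = g (R u v w) z" for u v w z
  have s: "k u v w z = - k v u w z" "k u v w z = - k u v z w" for u v w z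
    unfolding k_def using R_skew[of u v w] R_metric[of u v w z] g_sym[of w]
    by (simp_all add: g_simps)
  have b: "k u v w z + k v w u z + k w u v z = 0" for u v w z
    using arg_cong[OF R_bianchi[of u v w], of "\<lambda>x. g x z"] by (simp add: k_def g_simps)
  have "k u v w z = k w z u v"
    using b[of u v w z] b[of v w z u] b[of w z u v] b[of z u v w]
      s[of u v w z] s[of v w u z] s[of w u v z] s[of v w z u] s[of w z v u] s[of z v w u]
      s[of w z u v] s[of z u w v] s[of u w z v] s[of z u v w] s[of u v z w] s[of v z u w]
    by linarith
  then show ?thesis unfolding k_def .
qed

lemma R_linear3: "linear (R u v)"
  by (rule linear_of_skew) (rule R_metric)

text \<open>Pair symmetry carries the first slot to the third, where linearity follows from
  skewness.\<close>

lemma R_linear1: "linear (\<lambda>u. R u v w)"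
proof (rule linearI; rule g_eqI)
  show "g (R (a + b) v w) z = g (R a v w + R b v w) z" for a b z
    using R_pair_symmetry[of "a + b" v w z] R_pair_symmetry[of a v w z] R_pair_symmetry[of b v w z]
    by (simp add: g_simps linear_add[OF R_linear3])
  show "g (R (c *\<^sub>R a) v w) z = g (c *\<^sub>R R a v w) z" for a c z
    using R_pair_symmetry[of "c *\<^sub>R a" v w z] R_pair_symmetry[of a v w z]
    by (simp add: g_simps linear_scale[OF R_linear3])
qed

lemma R_linear2: "linear (\<lambda>v. R u v w)"
  using linear_compose_neg[OF R_linear1[of u w]] R_skew[of u _ w] by simp

lemma ricci_linear: "bilinear (\<lambda>u v. trace (matrix (\<lambda>w. R w u v)))"
  unfolding bilinear_def
  by (auto intro!: linearI simp: trace_def matrix_def linear_add[OF R_linear2] linear_scale[OF R_linear2]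
      linear_add[OF R_linear3] linear_scale[OF R_linear3] sum.distrib sum_distrib_left)

text \<open>In a null frame \<open>R_xi\<close> and the symmetries fix every Ricci component except
  S(\<open>e1\<close>, \<open>e2\<close>) = S(\<open>e2\<close>, \<open>e1\<close>) = k - 1. The
  trace -2 + 2(k - 1) then determines k.\<close>

lemma ricci_eq:
  assumes "metric_trace g (\<lambda>u v. trace (matrix (\<lambda>w. R w u v))) = - 6"
  shows "trace (matrix (\<lambda>w. R w u v)) = - 2 * g u v"
proof -
  obtain e1 e2 where "null_frame g \<phi> \<xi> \<eta> e1 e2" using null_frame_exists by blast
  then interpret null_frame g \<phi> \<xi> \<eta> e1 e2 .
  define S where "S u v = trace (matrix (\<lambda>w. R w u v))" for u v
  have S: "S u v = \<eta> (R \<xi> u v) + g (R e1 u v) e2 + g (R e2 u v) e1" for u v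
    unfolding S_def by (rule trace_frame[OF R_linear1])
  have bil: "bilinear S" unfolding S_def by (rule ricci_linear)
  define k where "k = g (R e1 e2 e1) e2"
  have self: "g (R u v w) w = 0" for u v w
    using R_metric[of u v w w] g_sym[of w "R u v w"] by simp
  have diag: "R u u w = 0" for u w
  proof -
    have "R u u w + R u u w = 0" using R_skew[of u u w] by (metis add.right_inverse)
    then show ?thesis unfolding scaleR_2[symmetric] by simp
  qed
  \<comment> \<open>Metric skewness moves \<open>\<xi>\<close> from the test slot into
    \<open>R\<close>, where \<open>R_xi\<close> applies.\<close>
  have eta_R: "\<eta> (R u v w) = - g w (\<eta> u *\<^sub>R v - \<eta> v *\<^sub>R u)" for u v w
    using R_metric[of u v w \<xi>] R_xi by simp
  have k': "g (R e2 e1 e2) e1 = k"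
    using R_metric[of e2 e1 e2 e1] R_skew[of e2 e1 e1] g_sym[of e2 "R e1 e2 e1"]
    by (simp add: k_def g_simps)
  \<comment> \<open>These are the only terms of the mixed Ricci components S(\<open>\<xi>\<close>,
    \<open>e1\<close>) and S(\<open>\<xi>\<close>, \<open>e2\<close>) not settled by skewness; pair
    symmetry moves \<open>\<xi>\<close> to the test slot.\<close>
  have 0: "g (R e1 \<xi> e1) e2 = 0" "g (R e2 \<xi> e2) e1 = 0"
    using R_pair_symmetry[of e1 \<xi> e1 e2] R_pair_symmetry[of e2 \<xi> e2 e1]
    by (simp_all add: eta_R g_simps)
  have vals: "S \<xi> \<xi> = - 2" "S e1 e1 = 0" "S e2 e2 = 0" "S e1 e2 = k - 1" "S e2 e1 = k - 1"
    "S \<xi> e1 = 0" "S \<xi> e2 = 0" "S e1 \<xi> = 0" "S e2 \<xi> = 0"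
    unfolding S using k' 0 self diag by (simp_all add: eta_R R_xi g_simps eta_simps k_def)
  have "metric_trace g S = - 6" using assms unfolding S_def .
  then have "S \<xi> \<xi> + S e1 e2 + S e2 e1 = - 6" using metric_trace_frame[OF bil] by simp
  then have k: "k = - 1" using vals by simp
  have lin: "linear (S u)" "linear (\<lambda>u. S u v)" for u v
    using bil by (simp_all add: bilinear_def)
  have lin': "linear (\<lambda>v. - 2 * g u v)" "linear (\<lambda>u. - 2 * g u v)" for u v
    by (rule linearI; simp add: g_simps algebra_simps)+
  have row: "S a v = - 2 * g a v"
    if "S a \<xi> = - 2 * g a \<xi>" "S a e1 = - 2 * g a e1" "S a e2 = - 2 * g a e2" for a
    using linear_frame_eqI[OF lin(1) lin'(1) that] .
  have "S u v = - 2 * g u v"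
    by (rule linear_frame_eqI[OF lin(2) lin'(2)]; rule row; simp add: vals k)
  then show ?thesis unfolding S_def .
qed

end


section \<open>Calculus in an atlas\<close>

locale smooth_atlas =
  fixes A :: "('a::{t2_space, second_countable_topology}, 'n::finite) atlas"
  assumes smooth_manifold: "smooth_manifold A"
begin

lemma chart_at_in: "chart_at A p \<in> A" and chart_at_dom: "p \<in> fst (chart_at A p)"
proof -
  have "\<exists>c. c \<in> A \<and> p \<in> fst c"
    using smooth_manifold unfolding smooth_manifold_def by (metis UNIV_I UN_E)
  from someI_ex[OF this] show "chart_at A p \<in> A" "p \<in> fst (chart_at A p)"
    unfolding chart_at_def by blast+
qed

lemma chart_homeomorphism:
  "c \<in> A \<Longrightarrow> homeomorphism (fst c) (snd c ` fst c) (snd c) (chart_inv c)"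
  and chart_dom_open: "c \<in> A \<Longrightarrow> open (fst c)"
  and chart_image_open: "c \<in> A \<Longrightarrow> open (snd c ` fst c)"
  using smooth_manifold unfolding smooth_manifold_def by blast+

lemma transition_smooth:
  "c \<in> A \<Longrightarrow> d \<in> A \<Longrightarrow> smooth_on (snd d \<circ> chart_inv c) (snd c ` (fst c \<inter> fst d))"
  using smooth_manifold unfolding smooth_manifold_def by blast

lemma chart_inv_chart [simp]: "c \<in> A \<Longrightarrow> q \<in> fst c \<Longrightarrow> chart_inv c (snd c q) = q"
  using homeomorphism_apply1[OF chart_homeomorphism] .

lemma chart_image_open_subset:
  assumes "c \<in> A" "open W"
  shows "open (snd c ` (fst c \<inter> W))"
proof -
  have "snd c ` (fst c \<inter> W) = snd c ` fst c \<inter> chart_inv c -` W"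
    using assms(1) by auto
  then show ?thesis
    using continuous_open_preimage[OF homeomorphism_cont2[OF chart_homeomorphism[OF assms(1)]]
        chart_image_open[OF assms(1)] assms(2)] by simp
qed

lemma transition_has_derivative:
  assumes "c \<in> A" "d \<in> A" "q \<in> fst c" "q \<in> fst d"
  shows "((\<lambda>x. snd d (chart_inv c x)) has_derivative coord_change c d q) (at (snd c q))"
  using smooth_on_has_derivative[OF transition_smooth[OF assms(1,2)]] assms(3,4)
  unfolding coord_change_def comp_def by blast

lemma coord_change_linear:
  "c \<in> A \<Longrightarrow> d \<in> A \<Longrightarrow> q \<in> fst c \<Longrightarrow> q \<in> fst d \<Longrightarrow> linear (coord_change c d q)"
  using transition_has_derivative has_derivative_linear by blast

text \<open>The chain rule: near the point, the transition from \<open>c\<close> to \<open>e\<close>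
  factors through \<open>d\<close>.\<close>

lemma coord_change_trans:
  assumes "c \<in> A" "d \<in> A" "e \<in> A" "q \<in> fst c" "q \<in> fst d" "q \<in> fst e"
  shows "coord_change d e q (coord_change c d q v) = coord_change c e q v"
proof -
  have 1: "((\<lambda>x. snd e (chart_inv d (snd d (chart_inv c x)))) has_derivative
      (\<lambda>v. coord_change d e q (coord_change c d q v))) (at (snd c q))"
    by (rule has_derivative_compose[OF transition_has_derivative])
      (use assms transition_has_derivative[of d e q] in auto)
  have "((\<lambda>x. snd e (chart_inv c x)) has_derivative
      (\<lambda>v. coord_change d e q (coord_change c d q v))) (at (snd c q))"
    by (rule has_derivative_transform_within_open[OF 1
        chart_image_open_subset[OF assms(1) chart_dom_open[OF assms(2)]]])
      (use assms in auto)
  from has_derivative_unique[OF this transition_has_derivative] assms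
  show ?thesis by metis
qed

lemma coord_change_self:
  assumes "c \<in> A" "q \<in> fst c"
  shows "coord_change c c q v = v"
proof -
  have "((\<lambda>x. snd c (chart_inv c x)) has_derivative (\<lambda>v. v)) (at (snd c q))"
    by (rule has_derivative_transform_within_open[OF has_derivative_ident
          chart_image_open[OF assms(1)]]) (use assms in auto)
  from has_derivative_unique[OF this transition_has_derivative[OF assms(1,1,2,2)]]
  show ?thesis by metis
qed

lemma coord_change_inverse:
  "c \<in> A \<Longrightarrow> d \<in> A \<Longrightarrow> q \<in> fst c \<Longrightarrow> q \<in> fst d \<Longrightarrow> coord_change d c q (coord_change c d q v) = v"
  using coord_change_trans coord_change_self by metis

lemma coord_field_chart_at: "coord_field A (chart_at A p) v p = v"
  unfolding coord_field_def by (rule coord_change_self[OF chart_at_in chart_at_dom])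

lemma vf_rep_chart:
  "c \<in> A \<Longrightarrow> q \<in> fst c \<Longrightarrow> vf_rep A c X (snd c q) = coord_change (chart_at A q) c q (X q)"
  by (simp add: vf_rep_def)

text \<open>The right side is written as a function of the coordinate point \<open>snd d q\<close>,
  so that it describes the representative on an open set and can be differentiated.\<close>

lemma vf_rep_coord_field:
  assumes "c \<in> A" "d \<in> A" "q \<in> fst c" "q \<in> fst d"
  shows "vf_rep A d (coord_field A c v) (snd d q) =
    frechet_derivative (snd d \<circ> chart_inv c) (at (snd c (chart_inv d (snd d q)))) v"
proof -
  have "vf_rep A d (coord_field A c v) (snd d q) = coord_change c d q v"
    unfolding vf_rep_chart[OF assms(2,4)] coord_field_def
    using assms coord_change_trans[OF assms(1) chart_at_in assms(2) assms(3) chart_at_dom assms(4)] by simp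
  then show ?thesis using assms by (simp add: coord_change_def)
qed

lemma vector_field_coord_field:
  assumes "c \<in> A"
  shows "vector_field_on A (fst c) (coord_field A c v)"
  unfolding vector_field_on_def
proof
  fix d assume d: "d \<in> A"
  let ?U = "snd d ` (fst d \<inter> fst c)"
  have "smooth_on (\<lambda>x. frechet_derivative (snd d \<circ> chart_inv c) (at ((snd c \<circ> chart_inv d) x)) v) ?U"
  proof (rule smooth_on_compose[where g = "snd c \<circ> chart_inv d",
        OF chart_image_open_subset[OF d chart_dom_open[OF assms]]])
    show "smooth_on (\<lambda>y. frechet_derivative (snd d \<circ> chart_inv c) (at y) v) (snd c ` (fst c \<inter> fst d))"
      by (rule smooth_on_frechet_derivative[OF transition_smooth[OF assms d]])
    show "smooth_on (snd c \<circ> chart_inv d) ?U" by (rule transition_smooth[OF d assms])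
    show "(snd c \<circ> chart_inv d) ` ?U \<subseteq> snd c ` (fst c \<inter> fst d)"
      using d by auto
  qed
  then show "smooth_on (vf_rep A d (coord_field A c v)) ?U"
    by (rule smooth_on_cong[OF chart_image_open_subset[OF d chart_dom_open[OF assms]], rotated])
      (use vf_rep_coord_field[OF assms d] in \<open>auto simp: comp_def\<close>)
qed

text \<open>The bracket is computed in the preferred chart at \<open>q\<close>, not in
  \<open>c\<close>. There the two terms are mixed second derivatives of the transition map, because
  the change back to \<open>c\<close> returns the directions \<open>u\<close> and \<open>v\<close>;
  these derivatives are symmetric.\<close>

lemma lie_bracket_coord_field:
  assumes "c \<in> A" "q \<in> fst c"
  shows "lie_bracket A (coord_field A c u) (coord_field A c v) q = 0"
proof -
  let ?d = "chart_at A q"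
  let ?F = "snd ?d \<circ> chart_inv c"
  let ?H = "\<lambda>v y. frechet_derivative ?F (at y) v"
  let ?U = "snd ?d ` (fst ?d \<inter> fst c)" and ?V = "snd c ` (fst c \<inter> fst ?d)"
  note d = chart_at_in[of q] chart_at_dom[of q]
  have V: "open ?V" "smooth_on ?F ?V" "snd c q \<in> ?V"
    using assms d chart_dom_open chart_image_open_subset transition_smooth by auto
  have D: "frechet_derivative (vf_rep A ?d (coord_field A c v)) (at (snd ?d q)) (coord_field A c u q)
      = frechet_derivative (?H v) (at (snd c q)) u" for u v
  proof -
    have H: "(?H v has_derivative frechet_derivative (?H v) (at (snd c q)))
        (at (snd c (chart_inv ?d (snd ?d q))))"
      using smooth_on_has_derivative[OF smooth_on_frechet_derivative[OF V(2)] V(3)] d by simp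
    have "((\<lambda>x. ?H v (snd c (chart_inv ?d x))) has_derivative
        (\<lambda>w. frechet_derivative (?H v) (at (snd c q)) (coord_change ?d c q w))) (at (snd ?d q))"
      using has_derivative_compose[OF transition_has_derivative[OF d(1) assms(1) d(2) assms(2)] H] .
    then have vd: "(vf_rep A ?d (coord_field A c v) has_derivative
        (\<lambda>w. frechet_derivative (?H v) (at (snd c q)) (coord_change ?d c q w))) (at (snd ?d q))"
      by (rule has_derivative_transform_within_open[OF _
          chart_image_open_subset[OF d(1) chart_dom_open[OF assms(1)]]])
        (use assms d vf_rep_coord_field[OF assms(1) d(1)] in auto)
    show ?thesis
      using frechet_derivative_at[OF vd, THEN fun_cong, of "coord_field A c u q"]
        coord_change_inverse[OF assms(1) d(1) assms(2) d(2), of u]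
      by (simp add: coord_field_def[of A c u])
  qed
  show ?thesis
    unfolding lie_bracket_def Let_def D using second_derivative_symmetric[OF V, of v u] by simp
qed

section \<open>First and second differentials of functions\<close>

lemma vector_field_subset: "vector_field_on A W X \<Longrightarrow> W' \<subseteq> W \<Longrightarrow> vector_field_on A W' X"
  unfolding vector_field_on_def by (blast intro: smooth_on_subset)

lemma vector_field_scaleR:
  assumes "open W" "smooth_fun_on A W f" "vector_field_on A W Y"
  shows "vector_field_on A W (\<lambda>q. f q *\<^sub>R Y q)"
  unfolding vector_field_on_def
proof
  fix c assume c: "c \<in> A"
  let ?U = "snd c ` (fst c \<inter> W)"
  have U: "open ?U" by (rule chart_image_open_subset[OF c assms(1)])
  have "smooth_on (\<lambda>x. fun_rep c f x *\<^sub>R vf_rep A c Y x) ?U"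
    using assms(2,3) c U Ck_on_scaleR unfolding smooth_on_def smooth_fun_on_def vector_field_on_def
    by blast
  then show "smooth_on (vf_rep A c (\<lambda>q. f q *\<^sub>R Y q)) ?U"
    by (rule smooth_on_cong[OF U, rotated])
      (use c coord_change_linear[OF chart_at_in c chart_at_dom] in
        \<open>auto simp: fun_rep_def vf_rep_def linear_scale\<close>)
qed

lemma smooth_fun_const: "smooth_fun_on A W (\<lambda>q. k)"
  unfolding smooth_fun_on_def fun_rep_def comp_def using smooth_on_const by blast

lemma fun_rep_has_derivative:
  assumes "c \<in> A" "smooth_fun_on A W f" "q \<in> W" "q \<in> fst c"
  shows "(fun_rep c f has_derivative frechet_derivative (fun_rep c f) (at (snd c q))) (at (snd c q))"
  using smooth_on_has_derivative assms unfolding smooth_fun_on_def by blast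

lemma differential_works:
  assumes "smooth_fun_on A W f" "q \<in> W"
  shows "(fun_rep (chart_at A q) f has_derivative differential A f q) (at (snd (chart_at A q) q))"
  using fun_rep_has_derivative[OF chart_at_in assms chart_at_dom] unfolding differential_def .

lemma differential_unique:
  "(fun_rep (chart_at A q) f has_derivative T) (at (snd (chart_at A q) q)) \<Longrightarrow> differential A f q = T"
  using frechet_derivative_at unfolding differential_def by metis

lemma fun_rep_has_derivative_cong:
  assumes "c \<in> A" "(fun_rep c f has_derivative T) (at (snd c q))" "open W" "q \<in> fst c" "q \<in> W"
    "\<And>r. r \<in> W \<Longrightarrow> r \<in> fst c \<Longrightarrow> f r = h r"
  shows "(fun_rep c h has_derivative T) (at (snd c q))"
  by (rule has_derivative_transform_within_open[OF assms(2) chart_image_open_subset[OF assms(1,3)]])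
    (use assms in \<open>auto simp: fun_rep_def\<close>)

lemma differential_const: "differential A (\<lambda>q. k) p v = 0"
proof -
  have "differential A (\<lambda>q. k) p = (\<lambda>v. 0)"
    by (rule differential_unique) (simp add: fun_rep_def comp_def)
  then show ?thesis by simp
qed

text \<open>\<open>differential\<close> uses a chart that jumps with \<open>q\<close>. Along a
  coordinate field it becomes a partial derivative in the single chart \<open>c\<close>, which can
  be differentiated again.\<close>

lemma differential_coord_field:
  assumes "c \<in> A" "open W" "smooth_fun_on A W f" "q \<in> W" "q \<in> fst c"
  shows "differential A f q (coord_field A c v q) = frechet_derivative (fun_rep c f) (at (snd c q)) v"
proof -
  let ?d = "chart_at A q"
  note d = chart_at_in[of q] chart_at_dom[of q]
  have 1: "((\<lambda>x. fun_rep c f (snd c (chart_inv ?d x))) has_derivative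
      (\<lambda>w. frechet_derivative (fun_rep c f) (at (snd c q)) (coord_change ?d c q w))) (at (snd ?d q))"
    by (rule has_derivative_compose[OF transition_has_derivative[OF d(1) assms(1) d(2) assms(5)]])
      (use fun_rep_has_derivative[OF assms(1,3,4,5)] d in simp)
  have "(fun_rep ?d f has_derivative
      (\<lambda>w. frechet_derivative (fun_rep c f) (at (snd c q)) (coord_change ?d c q w))) (at (snd ?d q))"
    by (rule has_derivative_transform_within_open[OF 1
          chart_image_open_subset[OF d(1) chart_dom_open[OF assms(1)]]])
      (use assms d in \<open>auto simp: fun_rep_def\<close>)
  from differential_unique[OF this] show ?thesis
    using coord_change_inverse[OF assms(1) d(1) assms(5) d(2)] unfolding coord_field_def by simp
qed

text \<open>The Hessian in the preferred coordinates at \<open>p\<close>. It is not a tensor; it is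
  the iterated derivative of \<open>f\<close> along the coordinate fields of \<open>v\<close> and
  then \<open>u\<close>.\<close>

definition second_differential :: "'a \<Rightarrow> ('a \<Rightarrow> real) \<Rightarrow> real ^ 'n \<Rightarrow> real ^ 'n \<Rightarrow> real" where
  "second_differential p f u v = (let c = chart_at A p in
     frechet_derivative (\<lambda>y. frechet_derivative (fun_rep c f) (at y) v) (at (snd c p)) u)"

lemma second_differential_sym:
  assumes "open W" "smooth_fun_on A W f" "p \<in> W"
  shows "second_differential p f u v = second_differential p f v u"
  unfolding second_differential_def Let_def
  by (rule second_derivative_symmetric[OF chart_image_open_subset[OF chart_at_in assms(1)]])
    (use assms chart_at_in chart_at_dom in \<open>auto simp: smooth_fun_on_def\<close>)

lemma second_differential_works:
  assumes "open W" "smooth_fun_on A W f" "p \<in> W"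
  shows "(fun_rep (chart_at A p) (\<lambda>q. differential A f q (coord_field A (chart_at A p) v q))
    has_derivative (\<lambda>u. second_differential p f u v)) (at (snd (chart_at A p) p))"
proof -
  let ?c = "chart_at A p"
  note c = chart_at_in[of p] chart_at_dom[of p]
  have sm: "smooth_on (fun_rep ?c f) (snd ?c ` (fst ?c \<inter> W))" "snd ?c p \<in> snd ?c ` (fst ?c \<inter> W)"
    using assms c by (auto simp: smooth_fun_on_def)
  have "((\<lambda>y. frechet_derivative (fun_rep ?c f) (at y) v) has_derivative
      (\<lambda>u. second_differential p f u v)) (at (snd ?c p))"
    using smooth_on_has_derivative[OF smooth_on_frechet_derivative[OF sm(1)] sm(2)]
    unfolding second_differential_def Let_def .
  then show ?thesis
    by (rule has_derivative_transform_within_open[OF _ chart_image_open_subset[OF c(1) assms(1)]])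
      (use assms c in \<open>auto simp: fun_rep_def[of _ "\<lambda>q. _ q"] differential_coord_field\<close>)
qed

end


section \<open>The Levi-Civita connection and its curvature\<close>

locale levi_civita = smooth_atlas A
  for A :: "('a::{t2_space, second_countable_topology}, 'n::finite) atlas" +
  fixes g :: "'a \<Rightarrow> real ^ 'n \<Rightarrow> real ^ 'n \<Rightarrow> real"
    and nabla :: "('a, 'n) connection"
  assumes metric: "semi_riemannian_metric A g"
    and levi_civita: "levi_civita_connection A g nabla"
begin

lemma g_bilinear: "bilinear (g p)" and g_sym: "g p u v = g p v u"
  and g_nondegenerate: "(\<And>v. g p u v = 0) \<Longrightarrow> u = 0"
  using metric unfolding semi_riemannian_metric_def by blast+

lemma g_smooth:
  "open W \<Longrightarrow> vector_field_on A W X \<Longrightarrow> vector_field_on A W Y \<Longrightarrow>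
    smooth_fun_on A W (\<lambda>q. g q (X q) (Y q))"
  using metric unfolding semi_riemannian_metric_def by blast

lemmas g_simps = bilinear_ladd[OF g_bilinear] bilinear_radd[OF g_bilinear]
  bilinear_lmul[OF g_bilinear] bilinear_rmul[OF g_bilinear]
  bilinear_lneg[OF g_bilinear] bilinear_rneg[OF g_bilinear]
  bilinear_lsub[OF g_bilinear] bilinear_rsub[OF g_bilinear]
  bilinear_lzero[OF g_bilinear] bilinear_rzero[OF g_bilinear]

lemma g_eqI: "(\<And>z. g p z u = g p z v) \<Longrightarrow> u = v"
  using g_nondegenerate[of p "u - v"] by (simp add: g_simps g_sym[of p _ z for z])

lemma affine: "affine_connection A nabla"
  using levi_civita unfolding levi_civita_connection_def by blast

context
  fixes W :: "'a set" and Y :: "'a \<Rightarrow> real ^ 'n" and p :: 'a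
  assumes W: "open W" and Y: "vector_field_on A W Y" and p: "p \<in> W"
begin

lemmas affine_at =
  affine[unfolded affine_connection_def, THEN spec, THEN spec, THEN mp, THEN mp, OF W Y]

lemma nabla_linear: "linear (\<lambda>v. nabla p v Y)"
  using affine_at p by blast

lemma nabla_add:
  "vector_field_on A W Z \<Longrightarrow> nabla p v (\<lambda>q. Y q + Z q) = nabla p v Y + nabla p v Z"
  using affine_at p by blast

lemma nabla_scaleR:
  "smooth_fun_on A W f \<Longrightarrow>
    nabla p v (\<lambda>q. f q *\<^sub>R Y q) = differential A f p v *\<^sub>R Y p + f p *\<^sub>R nabla p v Y"
  using affine_at p by blast

lemma nabla_cong: "(\<And>q. q \<in> W \<Longrightarrow> Z q = Y q) \<Longrightarrow> nabla p v Z = nabla p v Y"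
  using affine_at p by blast

text \<open>The zero field is the constant 0 times \<open>Y\<close>, so the Leibniz rule
  applies.\<close>

lemma nabla_0: "nabla p v (\<lambda>q. 0) = 0"
  using nabla_scaleR[OF smooth_fun_const, of v 0] by (simp add: differential_const)

lemma nabla_minus: "nabla p v (\<lambda>q. - Y q) = - nabla p v Y"
  using nabla_scaleR[OF smooth_fun_const, of v "- 1"] by (simp add: differential_const)

lemma cov_vector_field: "vector_field_on A W X \<Longrightarrow> vector_field_on A W (cov nabla X Y)"
  using affine_at by blast

lemma torsion_free:
  "vector_field_on A W X \<Longrightarrow> nabla p (X p) Y - nabla p (Y p) X = lie_bracket A X Y p"
  using levi_civita W Y p unfolding levi_civita_connection_def cov_def by blast

lemma metric_compatible:
  "vector_field_on A W X \<Longrightarrow>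
    differential A (\<lambda>q. g q (X q) (Y q)) p v = g p (nabla p v X) (Y p) + g p (X p) (nabla p v Y)"
  using levi_civita W Y p unfolding levi_civita_connection_def by blast

end

section \<open>Curvature symmetries through commuting coordinate fields\<close>

context
  fixes p :: 'a
begin

text \<open>These fields commute on \<open>N\<close> and take any prescribed value at the fixed
  point \<open>p\<close>. Outside this context they carry \<open>p\<close> as an extra
  argument.\<close>

definition "E v = coord_field A (chart_at A p) v"
definition "N = fst (chart_at A p)"

lemma N_nbhd: "open N" "p \<in> N"
  using chart_dom_open chart_at_in chart_at_dom unfolding N_def by blast+

lemma E_vector_field: "vector_field_on A N (E v)"
  unfolding N_def E_def by (rule vector_field_coord_field[OF chart_at_in])

lemma E_at: "E v p = v"
  unfolding E_def by (rule coord_field_chart_at)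

lemma lie_bracket_E: "q \<in> N \<Longrightarrow> lie_bracket A (E u) (E v) q = 0"
  unfolding N_def E_def by (rule lie_bracket_coord_field[OF chart_at_in])

lemma curvature_E:
  assumes "vector_field_on A N Y"
  shows "curvature A nabla (E u) (E v) Y p =
    nabla p u (cov nabla (E v) Y) - nabla p v (cov nabla (E u) Y)"
  using linear_0[OF nabla_linear[OF N_nbhd(1) assms N_nbhd(2)]] N_nbhd(2)
  by (simp add: curvature_def cov_def E_at lie_bracket_E)

text \<open>The function g(Y, Z) is differentiated twice by metric compatibility. Its second
  derivative is symmetric in \<open>u\<close>, \<open>v\<close>, and the products of first
  derivatives cancel on antisymmetrizing. Arbitrary fields are allowed so that tensoriality can be
  deduced.\<close>

lemma curvature_skew:
  assumes Y: "vector_field_on A N Y" and Z: "vector_field_on A N Z"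
  shows "g p (curvature A nabla (E u) (E v) Y p) (Z p) = - g p (Y p) (curvature A nabla (E u) (E v) Z p)"
proof -
  let ?f = "\<lambda>q. g q (Y q) (Z q)"
  let ?h = "\<lambda>v q. g q (cov nabla (E v) Y q) (Z q)" and ?k = "\<lambda>v q. g q (Y q) (cov nabla (E v) Z q)"
  have f: "smooth_fun_on A N ?f" by (rule g_smooth[OF N_nbhd(1) Y Z])
  have cY: "vector_field_on A N (cov nabla (E v) Y)" and cZ: "vector_field_on A N (cov nabla (E v) Z)" for v
    using cov_vector_field[OF N_nbhd(1)] Y Z N_nbhd(2) E_vector_field by blast+
  have second: "second_differential p ?f u v =
      g p (nabla p u (cov nabla (E v) Y)) (Z p) + g p (nabla p v Y) (nabla p u Z) +
      (g p (nabla p u Y) (nabla p v Z) + g p (Y p) (nabla p u (cov nabla (E v) Z)))" for u v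
  proof -
    note hk = differential_works[OF g_smooth[OF N_nbhd(1) cY Z] N_nbhd(2)]
      differential_works[OF g_smooth[OF N_nbhd(1) Y cZ] N_nbhd(2)]
    have sum: "(fun_rep (chart_at A p) (\<lambda>q. ?h v q + ?k v q) has_derivative
        (\<lambda>u. differential A (?h v) p u + differential A (?k v) p u)) (at (snd (chart_at A p) p))"
      using has_derivative_add[OF hk] by (simp add: fun_rep_def comp_def)
    \<comment> \<open>Metric compatibility holds on all of \<open>N\<close>, so the first derivative
      is known as a function near \<open>p\<close> and may be differentiated there.\<close>
    have "(fun_rep (chart_at A p) (\<lambda>q. differential A ?f q (E v q)) has_derivative
        (\<lambda>u. differential A (?h v) p u + differential A (?k v) p u)) (at (snd (chart_at A p) p))"
      by (rule fun_rep_has_derivative_cong[OF chart_at_in sum N_nbhd(1) chart_at_dom N_nbhd(2)])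
        (simp add: metric_compatible[OF N_nbhd(1) Z _ Y] cov_def)
    from has_derivative_unique[OF this second_differential_works[OF N_nbhd(1) f N_nbhd(2), of v, folded E_def]]
    have "second_differential p ?f u v = differential A (?h v) p u + differential A (?k v) p u"
      by metis
    then show ?thesis
      using metric_compatible[OF N_nbhd(1) Z N_nbhd(2) cY] metric_compatible[OF N_nbhd(1) cZ N_nbhd(2) Y]
      by (simp add: cov_def E_at)
  qed
  show ?thesis
    using second[of u v] second[of v u] second_differential_sym[OF N_nbhd(1) f N_nbhd(2), of u v]
    unfolding curvature_E[OF Y] curvature_E[OF Z] by (simp add: g_simps)
qed

text \<open>
  An operator on vector fields that is skew with respect to \<open>g\<close> is tensorial, because \<open>g\<close> is
  nondegenerate; so the extension of a tangent vector to a field does not matter.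
\<close>

lemma curvature_at_eq:
  assumes Y: "vector_field_on A N Y"
  shows "curvature_at A nabla p u v (Y p) = curvature A nabla (E u) (E v) Y p"
proof (rule g_eqI)
  fix z
  show "g p z (curvature_at A nabla p u v (Y p)) = g p z (curvature A nabla (E u) (E v) Y p)"
    using curvature_skew[OF E_vector_field E_vector_field, of u v z "Y p"] curvature_skew[OF E_vector_field Y, of u v z]
    by (simp add: curvature_at_def Let_def E_at flip: E_def)
qed

lemma curvature_at_metric:
  "g p (curvature_at A nabla p u v w) z = - g p w (curvature_at A nabla p u v z)"
  using curvature_skew[OF E_vector_field E_vector_field, of u v w z] by (simp add: curvature_at_def Let_def E_at flip: E_def)

lemma curvature_at_E:
  "curvature_at A nabla p u v w = nabla p u (cov nabla (E v) (E w)) - nabla p v (cov nabla (E u) (E w))"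
  using curvature_at_eq[OF E_vector_field, of u v w] by (simp add: E_at curvature_E[OF E_vector_field])

lemma curvature_at_antisym: "curvature_at A nabla p u v w = - curvature_at A nabla p v u w"
  by (simp add: curvature_at_E)

text \<open>For commuting fields torsion-freeness lets \<nabla> swap its two fields near
  \<open>p\<close>, and the six second derivatives cancel in pairs.\<close>

lemma curvature_at_bianchi:
  "curvature_at A nabla p u v w + curvature_at A nabla p v w u + curvature_at A nabla p w u v = 0"
proof -
  have "nabla p u (cov nabla (E v) (E w)) = nabla p u (cov nabla (E w) (E v))" for u v w
  proof (rule nabla_cong[OF N_nbhd(1) _ N_nbhd(2)])
    show "vector_field_on A N (cov nabla (E w) (E v))"
      using cov_vector_field[OF N_nbhd(1) E_vector_field N_nbhd(2) E_vector_field] .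
    show "cov nabla (E v) (E w) q = cov nabla (E w) (E v) q" if "q \<in> N" for q
      using torsion_free[OF N_nbhd(1) E_vector_field that E_vector_field, of v w] lie_bracket_E[OF that] by (simp add: cov_def)
  qed
  from this[of u w v] this[of v u w] this[of w v u]
  show ?thesis unfolding curvature_at_E by simp
qed

end

end


section \<open>Three-dimensional para-Sasakian manifolds\<close>

locale para_sasakian_3 = levi_civita A g nabla
  for A :: "('a::{t2_space, second_countable_topology}, 3) atlas" and g nabla +
  fixes \<phi> :: "'a \<Rightarrow> real ^ 3 \<Rightarrow> real ^ 3"
    and \<xi> :: "'a \<Rightarrow> real ^ 3"
    and \<eta> :: "'a \<Rightarrow> real ^ 3 \<Rightarrow> real"
  assumes para_sasakian: "para_sasakian A \<phi> \<xi> \<eta> g"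
begin

lemma paracontact_metric: "paracontact_metric A \<phi> \<xi> \<eta> g"
  and normal: "normal_structure A \<phi> \<xi> \<eta>"
  and almost_metric: "almost_paracontact_metric A \<phi> \<xi> \<eta> g"
  and almost: "almost_paracontact A \<phi> \<xi> \<eta>"
  using para_sasakian
  unfolding para_sasakian_def paracontact_metric_def almost_paracontact_metric_def by blast+

sublocale pt: paracontact_space "g p" "\<phi> p" "\<xi> p" "\<eta> p" for p
proof (rule paracontact_space.intro)
  \<comment> \<open>Dimension three forces \<open>m\<close> to be 1.\<close>
  obtain m where "3 = 2 * m + 1" and "dim {v. \<eta> p v = 0 \<and> \<phi> p v = v} = m"
    "dim {v. \<eta> p v = 0 \<and> \<phi> p v = - v} = m"
    using almost unfolding almost_paracontact_def by auto
  then show "dim {v. \<eta> p v = 0 \<and> \<phi> p v = v} = 1" "dim {v. \<eta> p v = 0 \<and> \<phi> p v = - v} = 1"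
    by simp_all
  show "linear (\<phi> p)"
    using almost unfolding almost_paracontact_def endo_field_def by simp
  show "linear (\<eta> p)"
    using almost unfolding almost_paracontact_def one_form_def by simp
  show "\<eta> p (\<xi> p) = 1"
    using almost unfolding almost_paracontact_def by simp
  show "\<phi> p (\<phi> p v) = v - \<eta> p v *\<^sub>R \<xi> p" for v
    using almost unfolding almost_paracontact_def by simp
  show "g p (\<phi> p u) (\<phi> p v) = - g p u v + \<eta> p u * \<eta> p v" for u v
    using almost_metric unfolding almost_paracontact_metric_def by blast
qed (use g_bilinear g_sym g_nondegenerate in blast)+

lemma xi_field: "vector_field_on A W \<xi>"
  using almost vector_field_subset unfolding almost_paracontact_def by blast

lemma phi_field: "open W \<Longrightarrow> vector_field_on A W Y \<Longrightarrow> vector_field_on A W (\<lambda>q. \<phi> q (Y q))"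
  using almost unfolding almost_paracontact_def endo_field_def by blast

lemma eta_smooth: "open W \<Longrightarrow> vector_field_on A W Y \<Longrightarrow> smooth_fun_on A W (\<lambda>q. \<eta> q (Y q))"
  using almost unfolding almost_paracontact_def one_form_def by blast

section \<open>Covariant derivatives of the structure tensors\<close>

text \<open>The usual derivative of the tensor \<open>\<phi>\<close> applied to \<open>Y\<close>,
  stated for a field; \<open>nabla_phi_eq\<close> shows that only the value of \<open>Y\<close> at
  the point matters.\<close>

definition nabla_phi :: "'a \<Rightarrow> real ^ 3 \<Rightarrow> ('a \<Rightarrow> real ^ 3) \<Rightarrow> real ^ 3" where
  "nabla_phi p u Y = nabla p u (\<lambda>q. \<phi> q (Y q)) - \<phi> p (nabla p u Y)"

lemma nabla_phi_xi: "nabla_phi p u \<xi> = - \<phi> p (nabla p u \<xi>)"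
  using nabla_0[OF open_UNIV xi_field, of p u] by (simp add: nabla_phi_def)

context
  fixes p :: 'a
begin

abbreviation "E\<^sub>p \<equiv> E p"
abbreviation "N\<^sub>p \<equiv> N p"

lemma phi_E: "vector_field_on A N\<^sub>p (\<lambda>q. \<phi> q (E\<^sub>p v q))"
  by (rule phi_field[OF N_nbhd(1) E_vector_field])

text \<open>The relation g(\<phi> Y, Z) = g(-Y, \<phi> Z) is differentiated along
  \<open>u\<close>.\<close>

lemma nabla_phi_skew:
  assumes Y: "vector_field_on A N\<^sub>p Y" and Z: "vector_field_on A N\<^sub>p Z"
  shows "g p (nabla_phi p u Y) (Z p) = - g p (Y p) (nabla_phi p u Z)"
proof -
  have fY: "vector_field_on A N\<^sub>p (\<lambda>q. \<phi> q (Y q))" and fZ: "vector_field_on A N\<^sub>p (\<lambda>q. \<phi> q (Z q))"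
    using phi_field[OF N_nbhd(1)] Y Z by blast+
  have "(\<lambda>q. g q (\<phi> q (Y q)) (Z q)) = (\<lambda>q. g q (- Y q) (\<phi> q (Z q)))"
    by (simp add: pt.g_phi_left g_simps)
  moreover have mY: "vector_field_on A N\<^sub>p (\<lambda>q. - Y q)"
    using vector_field_scaleR[OF N_nbhd(1) smooth_fun_const Y, of "- 1"] by simp
  ultimately have "g p (nabla p u (\<lambda>q. \<phi> q (Y q))) (Z p) + g p (\<phi> p (Y p)) (nabla p u Z) =
      g p (- nabla p u Y) (\<phi> p (Z p)) + g p (- Y p) (nabla p u (\<lambda>q. \<phi> q (Z q)))"
    using metric_compatible[OF N_nbhd(1) Z N_nbhd(2) fY, of u] metric_compatible[OF N_nbhd(1) fZ N_nbhd(2) mY, of u]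
    by (simp add: nabla_minus[OF N_nbhd(1) Y N_nbhd(2)])
  then show ?thesis
    by (simp add: nabla_phi_def g_simps pt.g_phi_left)
qed

text \<open>Tensoriality follows from skewness and nondegeneracy, as for the curvature.\<close>

lemma nabla_phi_eq:
  assumes Y: "vector_field_on A N\<^sub>p Y"
  shows "nabla_phi p u (E\<^sub>p (Y p)) = nabla_phi p u Y"
proof (rule g_eqI)
  fix z
  show "g p z (nabla_phi p u (E\<^sub>p (Y p))) = g p z (nabla_phi p u Y)"
    using nabla_phi_skew[OF E_vector_field E_vector_field, of u z "Y p"] nabla_phi_skew[OF E_vector_field Y, of u z] by (simp add: E_at)
qed

text \<open>This is d\<eta> = \<Phi> without its bracket term; the 2 comes from the normalization of
  the exterior derivative. It is stated throughout \<open>N\<^sub>p\<close> for later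
  differentiation.\<close>

lemma d_eta_E:
  assumes q: "q \<in> N\<^sub>p"
  shows "2 * g q (E\<^sub>p u q) (\<phi> q (E\<^sub>p v q)) =
    differential A (\<lambda>q. \<eta> q (E\<^sub>p v q)) q (E\<^sub>p u q) - differential A (\<lambda>q. \<eta> q (E\<^sub>p u q)) q (E\<^sub>p v q)"
proof -
  have "exterior_derivative A \<eta> (E\<^sub>p u) (E\<^sub>p v) q = g q (E\<^sub>p u q) (\<phi> q (E\<^sub>p v q))"
    using paracontact_metric N_nbhd(1) E_vector_field q
    unfolding paracontact_metric_def fundamental_form_def by blast
  then show ?thesis
    by (simp add: exterior_derivative_def lie_bracket_E[OF q] pt.eta_simps)
qed

lemma differential_eta:
  assumes Y: "vector_field_on A N\<^sub>p Y"
  shows "differential A (\<lambda>q. \<eta> q (Y q)) p u = \<eta> p (nabla p u Y) + g p (Y p) (nabla p u \<xi>)"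
  using metric_compatible[OF N_nbhd(1) xi_field N_nbhd(2) Y, of u] by (simp add: pt.g_xi_right)

lemma nabla_E_sym: "nabla p u (E\<^sub>p v) = nabla p v (E\<^sub>p u)"
  using torsion_free[OF N_nbhd(1) E_vector_field N_nbhd(2) E_vector_field, of p v u] lie_bracket_E[OF N_nbhd(2), of p v u] by (simp add: E_at)

text \<open>In d\<eta> = \<Phi> at \<open>p\<close>, the derivatives of the coordinate fields are
  symmetric and cancel, leaving only those of \<open>\<xi>\<close>.\<close>

lemma nabla_xi_antisym:
  "g p (nabla p u \<xi>) v - g p (nabla p v \<xi>) u = 2 * g p u (\<phi> p v)"
  using d_eta_E[OF N_nbhd(2), of u v] nabla_E_sym[of u v] g_sym[of p v] g_sym[of p u]
  by (simp add: differential_eta[OF E_vector_field] E_at)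

text \<open>The constant \<eta>(\<xi>) = g(\<xi>, \<xi>) is differentiated.\<close>

lemma eta_nabla_xi: "\<eta> p (nabla p u \<xi>) = 0"
  using differential_eta[OF xi_field, of u] by (simp add: differential_const pt.g_xi_left)

text \<open>The identity \<open>phi_phi\<close> is differentiated along \<open>u\<close>, with the
  Leibniz rule on \<eta>(E) \<xi>.\<close>

lemma nabla_phi_E_phi:
  "nabla_phi p u (E\<^sub>p (\<phi> p v)) + \<phi> p (nabla_phi p u (E\<^sub>p v)) =
    - g p v (nabla p u \<xi>) *\<^sub>R \<xi> p - \<eta> p v *\<^sub>R nabla p u \<xi>"
proof -
  let ?f = "\<lambda>q. \<eta> q (E\<^sub>p v q)"
  have f: "smooth_fun_on A N\<^sub>p ?f" by (rule eta_smooth[OF N_nbhd(1) E_vector_field])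
  have "E\<^sub>p v = (\<lambda>q. \<phi> q (\<phi> q (E\<^sub>p v q)) + ?f q *\<^sub>R \<xi> q)"
    by (simp add: pt.phi_phi)
  then have "nabla p u (E\<^sub>p v) = nabla p u (\<lambda>q. \<phi> q (\<phi> q (E\<^sub>p v q)) + ?f q *\<^sub>R \<xi> q)"
    by simp
  also have "\<dots> = nabla p u (\<lambda>q. \<phi> q (\<phi> q (E\<^sub>p v q))) + nabla p u (\<lambda>q. ?f q *\<^sub>R \<xi> q)"
    by (rule nabla_add[OF N_nbhd(1) phi_field[OF N_nbhd(1) phi_E] N_nbhd(2) vector_field_scaleR[OF N_nbhd(1) f xi_field]])
  also have "nabla p u (\<lambda>q. ?f q *\<^sub>R \<xi> q) =
      (\<eta> p (nabla p u (E\<^sub>p v)) + g p v (nabla p u \<xi>)) *\<^sub>R \<xi> p + \<eta> p v *\<^sub>R nabla p u \<xi>"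
    using nabla_scaleR[OF N_nbhd(1) xi_field N_nbhd(2) f, of u] by (simp add: differential_eta[OF E_vector_field] E_at)
  finally have ff: "nabla p u (\<lambda>q. \<phi> q (\<phi> q (E\<^sub>p v q))) = nabla p u (E\<^sub>p v) -
      ((\<eta> p (nabla p u (E\<^sub>p v)) + g p v (nabla p u \<xi>)) *\<^sub>R \<xi> p + \<eta> p v *\<^sub>R nabla p u \<xi>)"
    unfolding eq_diff_eq by (rule sym)
  \<comment> \<open>By tensoriality the coordinate field through \<open>\<phi> p v\<close> may be
    replaced by \<phi> E, which brings in the square of \<open>\<phi>\<close> as a field.\<close>
  have "nabla_phi p u (E\<^sub>p (\<phi> p v)) = nabla p u (\<lambda>q. \<phi> q (\<phi> q (E\<^sub>p v q))) -
      \<phi> p (nabla p u (\<lambda>q. \<phi> q (E\<^sub>p v q)))"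
    using nabla_phi_eq[OF phi_E, of u v] by (simp only: nabla_phi_def E_at)
  moreover have "\<phi> p (nabla_phi p u (E\<^sub>p v)) = \<phi> p (nabla p u (\<lambda>q. \<phi> q (E\<^sub>p v q))) -
      (nabla p u (E\<^sub>p v) - \<eta> p (nabla p u (E\<^sub>p v)) *\<^sub>R \<xi> p)"
    by (simp only: nabla_phi_def pt.phi_simps pt.phi_phi)
  ultimately show ?thesis
    unfolding ff by (simp add: scaleR_left_distrib)
qed

text \<open>Normality is evaluated with second argument \<open>\<xi>\<close>: d\<eta> vanishes there
  and two brackets involve \<phi> \<xi> = 0. The other brackets become covariant derivatives by
  torsion-freeness.\<close>

lemma normal_xi:
  "\<phi> p (\<phi> p (nabla p u \<xi>) - nabla p (\<phi> p u) \<xi> + nabla_phi p (\<xi> p) (E\<^sub>p u)) = 0"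
proof -
  have "nijenhuis A \<phi> (E\<^sub>p u) \<xi> p - (2 * exterior_derivative A \<eta> (E\<^sub>p u) \<xi> p) *\<^sub>R \<xi> p = 0"
    using normal N_nbhd E_vector_field xi_field unfolding normal_structure_def by blast
  moreover have "exterior_derivative A \<eta> (E\<^sub>p u) \<xi> p = 0"
  proof -
    have "exterior_derivative A \<eta> (E\<^sub>p u) \<xi> p = g p (E\<^sub>p u p) (\<phi> p (\<xi> p))"
      using paracontact_metric N_nbhd E_vector_field[of p u] xi_field[of "N\<^sub>p"]
      unfolding paracontact_metric_def fundamental_form_def by blast
    then show ?thesis by (simp add: g_simps)
  qed
  ultimately have nij: "nijenhuis A \<phi> (E\<^sub>p u) \<xi> p = 0" by simp
  have zero: "vector_field_on A N\<^sub>p (\<lambda>q. 0)"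
    using phi_field[OF N_nbhd(1) xi_field] by simp
  have bracket_0: "lie_bracket A X (\<lambda>q. 0) p = 0" if "vector_field_on A N\<^sub>p X" for X
    using torsion_free[OF N_nbhd(1) zero N_nbhd(2) that] nabla_0[OF N_nbhd(1) that N_nbhd(2)]
      linear_0[OF nabla_linear[OF N_nbhd(1) that N_nbhd(2)]] by simp
  have "lie_bracket A (E\<^sub>p u) \<xi> p = nabla p u \<xi> - nabla p (\<xi> p) (E\<^sub>p u)"
    using torsion_free[OF N_nbhd(1) xi_field N_nbhd(2) E_vector_field, of p u] by (simp add: E_at)
  moreover have "lie_bracket A (\<lambda>q. \<phi> q (E\<^sub>p u q)) \<xi> p =
      nabla p (\<phi> p u) \<xi> - nabla p (\<xi> p) (\<lambda>q. \<phi> q (E\<^sub>p u q))"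
    using torsion_free[OF N_nbhd(1) xi_field N_nbhd(2) phi_E, of u] by (simp add: E_at)
  ultimately have "\<phi> p (\<phi> p (nabla p u \<xi>) - nabla p (\<phi> p u) \<xi> + nabla_phi p (\<xi> p) (E\<^sub>p u)) =
      nijenhuis A \<phi> (E\<^sub>p u) \<xi> p"
    by (simp add: nijenhuis_def bracket_0[OF E_vector_field] bracket_0[OF phi_E] nabla_phi_def pt.phi_simps)
  then show ?thesis using nij by simp
qed

text \<open>This is \<open>d\<Phi> = d d\<eta> = 0\<close>, evaluated on commuting fields.\<close>

lemma nabla_phi_cyclic:
  "g p u (nabla_phi p w (E\<^sub>p v)) + g p v (nabla_phi p u (E\<^sub>p w)) + g p w (nabla_phi p v (E\<^sub>p u)) = 0"
proof -
  define M where "M u v w = second_differential p (\<lambda>q. \<eta> q (E\<^sub>p u q)) v w" for u v w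
  note f = eta_smooth[OF N_nbhd(1) E_vector_field]
  have sym: "M u v w = M u w v" for u v w
    unfolding M_def by (rule second_differential_sym[OF N_nbhd(1) f N_nbhd(2)])
  \<comment> \<open>\<open>d_eta_E\<close> is differentiated along \<open>w\<close>; the right side
    becomes second derivatives of the functions \<eta>(E).\<close>
  have dPhi: "2 * (g p (nabla p w (E\<^sub>p u)) (\<phi> p v) + g p u (nabla p w (\<lambda>q. \<phi> q (E\<^sub>p v q)))) =
      M v w u - M u w v" for u v w
  proof -
    let ?c = "chart_at A p" and ?G = "\<lambda>q. g q (E\<^sub>p u q) (\<phi> q (E\<^sub>p v q))"
    let ?D = "\<lambda>u v q. differential A (\<lambda>q. \<eta> q (E\<^sub>p v q)) q (E\<^sub>p u q)"
    have "(fun_rep ?c (?D u v) has_derivative (\<lambda>w. M v w u)) (at (snd ?c p))" for u v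
      unfolding M_def using second_differential_works[OF N_nbhd(1) f N_nbhd(2), of _ _ u] unfolding E_def .
    from has_derivative_mult_left[OF has_derivative_diff[OF this[of v u] this[of u v]], of "1 / 2"]
    have 1: "(fun_rep ?c (\<lambda>q. (?D u v q - ?D v u q) * (1 / 2)) has_derivative
        (\<lambda>w. (M v w u - M u w v) * (1 / 2))) (at (snd ?c p))"
      by (simp add: fun_rep_def comp_def)
    have "(fun_rep ?c ?G has_derivative (\<lambda>w. (M v w u - M u w v) * (1 / 2))) (at (snd ?c p))"
      by (rule fun_rep_has_derivative_cong[OF chart_at_in 1 N_nbhd(1) chart_at_dom N_nbhd(2)])
        (simp flip: d_eta_E)
    from differential_unique[OF this]
    have "2 * differential A ?G p w = M v w u - M u w v" by simp
    then show ?thesis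
      using metric_compatible[OF N_nbhd(1) phi_E N_nbhd(2) E_vector_field, of u v w] by (simp add: E_at)
  qed
  have split: "g p u (nabla p w (\<lambda>q. \<phi> q (E\<^sub>p v q))) =
      g p u (nabla_phi p w (E\<^sub>p v)) - g p (nabla p w (E\<^sub>p v)) (\<phi> p u)" for u v w
    using pt.g_phi_left[of p u "nabla p w (E\<^sub>p v)"] g_sym[of p "\<phi> p u"]
    by (simp add: nabla_phi_def g_simps)
  \<comment> \<open>In the cyclic sum the terms \<open>M\<close> cancel by symmetry, and so do the
    derivatives of the coordinate fields, which are symmetric by \<open>nabla_E_sym\<close>.\<close>
  show ?thesis
    using dPhi[of w u v] dPhi[of u v w] dPhi[of v w u] sym[of u v w] sym[of v u w] sym[of w u v]
      nabla_E_sym[of u v] nabla_E_sym[of v w] nabla_E_sym[of u w]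
    unfolding split by (simp add: algebra_simps)
qed

lemma nabla_xi: "nabla p u \<xi> = - \<phi> p u"
proof -
  obtain e1 e2 where "null_frame (g p) (\<phi> p) (\<xi> p) (\<eta> p) e1 e2"
    using pt.null_frame_exists by blast
  then interpret null_frame "g p" "\<phi> p" "\<xi> p" "\<eta> p" e1 e2 .
  show ?thesis
  proof (rule reeb_derivative_eq[where D = "\<lambda>u v. nabla_phi p u (E\<^sub>p v)"])
    show "linear (\<lambda>u. nabla p u \<xi>)" by (rule nabla_linear[OF N_nbhd(1) xi_field N_nbhd(2)])
    show "g p (nabla_phi p u (E\<^sub>p v)) w = - g p v (nabla_phi p u (E\<^sub>p w))" for u v w
      using nabla_phi_skew[OF E_vector_field E_vector_field, of u v w] by (simp add: E_at)
    show "nabla_phi p u (E\<^sub>p (\<xi> p)) = - \<phi> p (nabla p u \<xi>)" for u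
      using nabla_phi_eq[OF xi_field] nabla_phi_xi by simp
  qed (rule nabla_xi_antisym eta_nabla_xi normal_xi nabla_phi_E_phi nabla_phi_cyclic)+
qed

end

lemma nabla_phi_E: "nabla_phi p u (E p v) = - g p u v *\<^sub>R \<xi> p + \<eta> p v *\<^sub>R u"
proof -
  obtain e1 e2 where "null_frame (g p) (\<phi> p) (\<xi> p) (\<eta> p) e1 e2"
    using pt.null_frame_exists by blast
  then interpret null_frame "g p" "\<phi> p" "\<xi> p" "\<eta> p" e1 e2 .
  show ?thesis
  proof (rule phi_derivative_eq[where D = "\<lambda>u v. nabla_phi p u (E p v)"])
    show "g p (nabla_phi p u (E p v)) w = - g p v (nabla_phi p u (E p w))" for u v w
      using nabla_phi_skew[OF E_vector_field E_vector_field, of p u v w] by (simp add: E_at)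
    show "nabla_phi p u (E p (\<phi> p v)) + \<phi> p (nabla_phi p u (E p v)) =
        g p v (\<phi> p u) *\<^sub>R \<xi> p + \<eta> p v *\<^sub>R \<phi> p u" for u v
      using nabla_phi_E_phi[of p u v] by (simp add: nabla_xi g_simps)
    show "nabla_phi p u (E p (\<xi> p)) = \<phi> p (\<phi> p u)" for u
      using nabla_phi_eq[OF xi_field] nabla_phi_xi by (simp add: nabla_xi pt.phi_simps)
  qed
qed

section \<open>Curvature along the Reeb field and the soliton equation\<close>

text \<open>Differentiating \<nabla>\<xi> = -\<phi> again gives the antisymmetrized derivative of
  \<open>\<phi>\<close>, and the g-terms in \<open>nabla_phi_E\<close> cancel.\<close>

lemma curvature_at_xi: "curvature_at A nabla p u v (\<xi> p) = \<eta> p u *\<^sub>R v - \<eta> p v *\<^sub>R u"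
proof -
  \<comment> \<open>\<open>nabla_xi\<close> holds at every point, so this is an equality of fields
    and can be differentiated at \<open>p\<close>.\<close>
  have "cov nabla (E p v) \<xi> = (\<lambda>q. - \<phi> q (E p v q))" for v
    by (simp add: cov_def nabla_xi)
  then have "nabla p u (cov nabla (E p v) \<xi>) = - nabla_phi p u (E p v) - \<phi> p (nabla p u (E p v))" for u v
    by (simp add: nabla_minus[OF N_nbhd(1) phi_E N_nbhd(2)] nabla_phi_def)
  then have "curvature A nabla (E p u) (E p v) \<xi> p =
      nabla_phi p v (E p u) - nabla_phi p u (E p v)"
    using nabla_E_sym[of p u v] by (simp add: curvature_E[OF xi_field])
  then show ?thesis
    unfolding curvature_at_eq[OF xi_field] nabla_phi_E by (simp add: g_sym[of p v u])
qed

sublocale curv: curvature_like "g p" "\<phi> p" "\<xi> p" "\<eta> p" "curvature_at A nabla p" for p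
  by unfold_locales
    (rule curvature_at_antisym curvature_at_bianchi curvature_at_metric curvature_at_xi)+

lemma ricci_tensor_eq:
  assumes "scalar_curvature A g nabla p = - 6"
  shows "ricci_tensor A nabla p u v = - 2 * g p u v"
  using curv.ricci_eq[of p u v] assms
  unfolding scalar_curvature_def ricci_tensor_def[abs_def] by simp

end

theorem theorem2:
  fixes A :: "('a::{t2_space, second_countable_topology}, 3) atlas"
    and \<phi> :: "'a \<Rightarrow> real ^ 3 \<Rightarrow> real ^ 3"
    and \<xi> :: "'a \<Rightarrow> real ^ 3"
    and \<eta> :: "'a \<Rightarrow> real ^ 3 \<Rightarrow> real"
    and g :: "'a \<Rightarrow> real ^ 3 \<Rightarrow> real ^ 3 \<Rightarrow> real"
    and nabla :: "('a, 3) connection"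
  assumes "smooth_manifold A"
    and "para_sasakian A \<phi> \<xi> \<eta> g"
    and "levi_civita_connection A g nabla"
    and "\<And>p. scalar_curvature A g nabla p = -6"
    and "yamabe_soliton A g nabla"
  shows "ricci_soliton A g nabla"
proof -
  have "semi_riemannian_metric A g"
    using assms(2)
    unfolding para_sasakian_def paracontact_metric_def almost_paracontact_metric_def by blast
  then interpret para_sasakian_3 A g nabla \<phi> \<xi> \<eta>
    using assms(1-3) by unfold_locales
  obtain V l where V: "vector_field_on A UNIV V"
    and L: "\<forall>W X Y. open W \<longrightarrow> vector_field_on A W X \<longrightarrow> vector_field_on A W Y \<longrightarrow>
      (\<forall>p\<in>W. lie_derivative A V g X Y p = (l - - 6) * g p (X p) (Y p))"
    using assms(5) unfolding yamabe_soliton_def assms(4) by blast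
  show ?thesis
    unfolding ricci_soliton_def
  \<comment> \<open>With S = -2 g the left side is ((l + 6) - 4 + 2 \<mu>) g, which fixes the
    constant \<mu>.\<close>
  proof (intro exI[of _ V] exI[of _ "- (l + 2) / 2"] conjI allI impI ballI V)
    fix W X Y p
    assume "open W" "vector_field_on A W X" "vector_field_on A W Y" "p \<in> W"
    then have "lie_derivative A V g X Y p = (l - - 6) * g p (X p) (Y p)" using L by blast
    then show "lie_derivative A V g X Y p + 2 * ricci_tensor A nabla p (X p) (Y p)
        + 2 * (- (l + 2) / 2) * g p (X p) (Y p) = 0"
      by (simp add: ricci_tensor_eq[OF assms(4)] field_simps)
  qed
qed

end
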